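(* Let $n,k,r$ be positive integers with $1\le r\le\min\{k,n-k\}$, $r(n-1)=k(n-k)$ and $r\ge\frac n4$. Then $$\chi_Q(J(n,k,k-r))=n.$$
   Context: For integers $0\le s\le k\le n$, the generalized Johnson graph $J(n,k,s)$ has as vertices all $k$-element subsets of $[n]=\{1,\dots,n\}$, and two distinct vertices $A,B$ are adjacent if and only if $|A\cap B|=s$. Quantum chromatic number: let $G$ be a finite simple graph and $c$ a positive integer. A quantum $c$-coloring of $G$ consists of a positive integer $m$ and Hermitian projectors $\mathbf{P}_{v,\alpha}\in\mathbb{C}^{m\times m}$ ($v\in V(G)$, $\alpha\in\{1,\dots,c\}$), i.e. $\mathbf{P}_{v,\alpha}^*=\mathbf{P}_{v,\alpha}=\mathbf{P}_{v,\alpha}^2$, such that (1) for every vertex $v$, $\mathbf{P}_{v,\alpha}\mathbf{P}_{v,\beta}=\mathbf{O}$ for $\alpha\ne\beta$ and $\sum_{\alpha=1}^c\mathbf{P}_{v,\alpha}=\mathbf{I}_m$; (2) for every edge $uv$ and every color $\alpha$, $\mathbf{P}_{u,\alpha}\mathbf{P}_{v,\alpha}=\mathbf{O}$. The quantum chromatic number $\chi_Q(G)$ is the least $c$ for which a quantum $c$-coloring of $G$ exists. *)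

theory Defs
  imports "Graph_Theory.Pair_Digraph" "Jordan_Normal_Form.Schur_Decomposition"
begin

text \<open>Simple graphs are represented as symmetric loop-free digraphs without parallel arcs
  (locale \<^locale>\<open>pair_graph\<close>): an edge \<open>uv\<close> is the pair of arcs \<open>(u, v)\<close> and \<open>(v, u)\<close>.\<close>

definition generalized_johnson_graph :: "nat \<Rightarrow> nat \<Rightarrow> nat \<Rightarrow> nat set pair_pre_digraph" where
  "generalized_johnson_graph n k s =
     (let V = {A. A \<subseteq> {1..n} \<and> card A = k}
      in \<lparr> pverts = V,
           parcs = {(A, B). A \<in> V \<and> B \<in> V \<and> A \<noteq> B \<and> card (A \<inter> B) = s} \<rparr>)"

lemma pverts_generalized_johnson_graph:
  "pverts (generalized_johnson_graph n k s) = {A. A \<subseteq> {1..n} \<and> card A = k}"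
  by (simp add: generalized_johnson_graph_def Let_def)

lemma parcs_generalized_johnson_graph:
  "parcs (generalized_johnson_graph n k s) =
     {(A, B). A \<subseteq> {1..n} \<and> card A = k \<and> B \<subseteq> {1..n} \<and> card B = k \<and>
              A \<noteq> B \<and> card (A \<inter> B) = s}"
  by (auto simp: generalized_johnson_graph_def Let_def)

lemma pair_graph_generalized_johnson_graph: "pair_graph (generalized_johnson_graph n k s)"
proof -
  let ?G = "generalized_johnson_graph n k s"
  have "pverts ?G \<subseteq> Pow {1..n}"
    by (auto simp: pverts_generalized_johnson_graph)
  then have fin: "finite (pverts ?G)"
    by (rule finite_subset) simp
  have "parcs ?G \<subseteq> pverts ?G \<times> pverts ?G"
    by (auto simp: pverts_generalized_johnson_graph parcs_generalized_johnson_graph)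
  then have "finite (parcs ?G)"
    by (rule finite_subset) (simp add: fin)
  moreover have "(B, A) \<in> parcs ?G" if "(A, B) \<in> parcs ?G" for A B
    using that by (simp add: parcs_generalized_johnson_graph Int_commute[of B A] eq_commute[of B A])
  then have "symmetric ?G"
    by (simp add: symmetric_def symI)
  ultimately show ?thesis
    using fin
    by unfold_locales
      (simp_all add: pverts_generalized_johnson_graph parcs_generalized_johnson_graph
        split: prod.splits)
qed

definition hermitian_projector :: "nat \<Rightarrow> complex mat \<Rightarrow> bool" where
  "hermitian_projector m P \<longleftrightarrow> P \<in> carrier_mat m m \<and> mat_adjoint P = P \<and> P * P = P"

definition quantum_coloring ::
    "'v pair_pre_digraph \<Rightarrow> nat \<Rightarrow> nat \<Rightarrow> ('v \<Rightarrow> nat \<Rightarrow> complex mat) \<Rightarrow> bool" where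
  "quantum_coloring G c m P \<longleftrightarrow>
     (\<forall>v\<in>pverts G. \<forall>\<alpha>\<in>{1..c}. hermitian_projector m (P v \<alpha>)) \<and>
     (\<forall>v\<in>pverts G. \<forall>\<alpha>\<in>{1..c}. \<forall>\<beta>\<in>{1..c}. \<alpha> \<noteq> \<beta> \<longrightarrow> P v \<alpha> * P v \<beta> = 0\<^sub>m m m) \<and>
     (\<forall>v\<in>pverts G. (\<Oplus>\<^bsub>ring_mat TYPE(complex) m ()\<^esub>\<alpha>\<in>{1..c}. P v \<alpha>) = 1\<^sub>m m) \<and>
     (\<forall>(u, v)\<in>parcs G. \<forall>\<alpha>\<in>{1..c}. P u \<alpha> * P v \<alpha> = 0\<^sub>m m m)"

definition quantum_colorable :: "'v pair_pre_digraph \<Rightarrow> nat \<Rightarrow> bool" where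
  "quantum_colorable G c \<longleftrightarrow> (\<exists>m>0. \<exists>P. quantum_coloring G c m P)"

definition quantum_chromatic_number :: "'v pair_pre_digraph \<Rightarrow> nat" where
  "quantum_chromatic_number G = (LEAST c. 0 < c \<and> quantum_colorable G c)"

text \<open>The minimum exists for every finite loop-free graph: colour the vertices injectively,
  with projectors of size 1.\<close>

lemma (in pair_graph) quantum_colorable_exists: "\<exists>c>0. quantum_colorable G c"
proof -
  obtain f :: "'a \<Rightarrow> nat" and N where f: "f ` pverts G = {i. i < N}" "inj_on f (pverts G)"
    using finite_imp_inj_to_nat_seg[OF pair_finite_verts] by blast
  let ?R = "ring_mat TYPE(complex) 1 ()"
  define P :: "'a \<Rightarrow> nat \<Rightarrow> complex mat"
    where "P v \<alpha> = (if \<alpha> = Suc (f v) then 1\<^sub>m 1 else 0\<^sub>m 1 1)" for v \<alpha>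
  interpret R: semiring ?R
    by (rule semiring_mat)
  have adj: "mat_adjoint (1\<^sub>m 1 :: complex mat) = 1\<^sub>m 1"
    "mat_adjoint (0\<^sub>m 1 1 :: complex mat) = 0\<^sub>m 1 1"
    by (auto simp: mat_adjoint_def mat_of_rows_def intro!: eq_matI)
  have sum: "(\<Oplus>\<^bsub>?R\<^esub>\<alpha>\<in>{1..Suc N}. P v \<alpha>) = 1\<^sub>m 1" if "v \<in> pverts G" for v
  proof -
    have "f v < N" using f(1) that by blast
    then have mem: "Suc (f v) \<in> {1..Suc N}" by simp
    have "(\<Oplus>\<^bsub>?R\<^esub>\<alpha>\<in>{1..Suc N}. P v \<alpha>) =
        (\<Oplus>\<^bsub>?R\<^esub>\<alpha>\<in>{1..Suc N}. if Suc (f v) = \<alpha> then 1\<^sub>m 1 else \<zero>\<^bsub>?R\<^esub>)"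
      by (rule R.finsum_cong') (auto simp: P_def ring_mat_simps)
    also have "\<dots> = 1\<^sub>m 1"
      using R.add.finprod_singleton[OF mem, of "\<lambda>_. 1\<^sub>m 1"] by (simp add: ring_mat_simps)
    finally show ?thesis .
  qed
  have neq: "f u \<noteq> f v" if "(u, v) \<in> parcs G" for u v
    using that f(2) wellformed' by (metis inj_onD pair_no_loops fst_conv snd_conv)
  have proj: "hermitian_projector 1 (P v \<alpha>)" for v \<alpha>
    using adj unfolding hermitian_projector_def P_def by simp
  have orth: "P v \<alpha> * P v \<beta> = 0\<^sub>m 1 1" if "\<alpha> \<noteq> \<beta>" for v \<alpha> \<beta>
    using that by (simp add: P_def)
  have edge: "P u \<alpha> * P v \<alpha> = 0\<^sub>m 1 1" if "(u, v) \<in> parcs G" for u v \<alpha>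
    using neq[OF that] by (simp add: P_def)
  have "quantum_coloring G (Suc N) 1 P"
    unfolding quantum_coloring_def
  proof (intro conjI ballI impI)
    fix e assume "e \<in> parcs G"
    then show "case e of (u, v) \<Rightarrow> \<forall>\<alpha>\<in>{1..Suc N}. P u \<alpha> * P v \<alpha> = 0\<^sub>m 1 1"
      using edge by (cases e) simp
  qed (rule proj orth sum; assumption?)+
  then show ?thesis
    unfolding quantum_colorable_def
    by (intro exI[of _ "Suc N"] conjI exI[of _ "1::nat"] exI[of _ P]) simp_all
qed

end

theory Submission
  imports Defs "HOL-Analysis.Function_Topology" "HOL-Combinatorics.Transposition"
begin

text \<open>Write \<open>l = n - k\<close>. Upper bound: vectors with entry \<open>cis \<theta>\<close> on the set and \<open>1\<close> off it are flat,
  and orthogonal on adjacent sets when \<open>cos \<theta> = 1 - n / (2 r)\<close>, which is possible as \<open>4 r \<ge> n\<close>;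
  twisting them by the \<open>n\<close> Fourier characters yields rank-one projectors.

  Lower bound: if the adjacency matrix \<open>A\<close> of a \<open>d\<close>-regular graph satisfies \<open>A + t I \<ge> 0\<close>, then
  \<open>c \<ge> 1 + d / t\<close> (Hoffman bound); here \<open>t = d / (n - 1)\<close>. A least eigenvector of \<open>A\<close>, antisymmetrized
  over a maximal set of disjoint transpositions, shows that the least eigenvalue is a value
  \<open>E(j)\<close>, \<open>j \<le> min k l\<close>, of the Eberlein polynomial. It remains to see \<open>\<bar>E(j)\<bar> \<le> E(0) / (n - 1)\<close>
  for \<open>j \<ge> 1\<close>. The hypotheses force \<open>{k, l} = {2m - 1, 2m}\<close>, \<open>r = m\<close>, or
  \<open>{k, l} = {2s\<^sup>2 - s, 2s\<^sup>2 + s}\<close>, \<open>r = s\<^sup>2\<close>, or \<open>k = l = r = 1\<close>. One has equality at \<open>j = 1, 2\<close>, a three-term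
  recurrence propagates the bound to larger \<open>j\<close> until it becomes unstable, and beyond that the
  triangle inequality suffices.\<close>

section \<open>Eigenvalues of the generalized Johnson graphs\<close>

text \<open>Eigenvalue of J(k + l, k, k - r) on its \<open>j\<close>-th eigenspace: of
  \<open>j\<close> matched pairs, \<open>i\<close> are swapped with a sign -1 each, while
  \<open>r - i\<close> of the other points of a vertex are exchanged for points outside it.\<close>

definition eberlein :: "nat \<Rightarrow> nat \<Rightarrow> nat \<Rightarrow> nat \<Rightarrow> real" where
  "eberlein k l r j =
     (\<Sum>i\<le>r. (- 1) ^ i * real ((j choose i) * ((k - j) choose (r - i)) * ((l - j) choose (r - i))))"

text \<open>With \<open>1 / z! = 0\<close> for negative \<open>z\<close>, the rule \<open>rfact (z - 1) = z * rfact z\<close> has no side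
  condition, so all terms of the recurrence below are polynomial multiples of a single one.\<close>

definition rfact :: "int \<Rightarrow> real" where
  "rfact z = (if z < 0 then 0 else 1 / fact (nat z))"

section \<open>Reciprocal factorials and the telescoping recurrence in \<open>j\<close>\<close>

lemma rfact_diff_1: "rfact (z - 1) = of_int z * rfact z"
proof (cases "z \<ge> 1")
  case True
  then have "z = int (Suc (nat z - 1))" by simp
  then obtain m where m: "z = int (Suc m)" by blast
  have "nat (z - 1) = m" "nat z = Suc m"
    by (simp_all add: m)
  with True show ?thesis by (simp add: rfact_def m del: of_nat_Suc)
qed (auto simp: rfact_def)

lemma rfact_eq_mult: "w = z - 1 \<Longrightarrow> rfact w = of_int z * rfact z"
  using rfact_diff_1 by simp

lemma rfact_neg [simp]: "z < 0 \<Longrightarrow> rfact z = 0"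
  by (simp add: rfact_def)

lemma binomial_rfact: "real (a choose b) = fact a * rfact (int b) * rfact (int a - int b)"
proof (cases "b \<le> a")
  case True
  then have "nat (int a - int b) = a - b" by simp
  with True show ?thesis
    by (simp add: rfact_def binomial_fact field_simps)
qed (simp add: binomial_eq_0)

text \<open>The certificate identity is symmetric in \<open>x = k - j + 1\<close> and
  \<open>y = l - j + 1\<close>; written with \<open>N = x + y\<close> and
  \<open>M = (x - s) * (y - s)\<close> it is a smaller polynomial identity. Here
  \<open>s = r - i\<close>, \<open>e = j + 1 - i\<close>, \<open>J = j + 1\<close>, and
  \<open>P1\<close>, \<open>P2\<close> are \<open>cert_poly\<close> at \<open>i\<close> and
  \<open>i + 1\<close>.\<close>

lemma certificate_reduced:
  fixes N M s e J :: real
  defines "w \<equiv> M + N * s - s * s"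
  defines "ab \<equiv> M + 1 - (N - 2*s) + e * (N-2*s-2) + e*e"
  defines "P1 \<equiv> N * J * (M + 1 - (N - 2*s)) + (N-2) * (N * ab - e * w - e * (e-1-s) * N)"
  defines "P2 \<equiv> N * J * M + (N-2) * (N * ab + (1-e) * (w + (e-1-s)*N))"
  shows "N*(N+J-2)*J*M*(M + 1 - (N - 2*s)) + ((N-2)*(N-1)*N*(s+J-e) - N*(N+J-2)*(w-N+1) - (N-2)*(J-1)*w)*e*M
     + (N-2)*w*w*e*(e-1) = e*(s*s)*P2 + (J-e)*M*P1"
  unfolding P1_def P2_def ab_def w_def by Groebner_Basis.algebra

text \<open>The polynomial part of the telescoping (Zeilberger) certificate for the three-term recurrence.
  It is quadratic in \<open>i\<close> and was found by interpolation: the certificate identity fixes its values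
  where one of the factors \<open>j + 1 - i\<close>, \<open>K\<close>, \<open>L\<close> vanishes.\<close>

definition cert_poly :: "real \<Rightarrow> real \<Rightarrow> real \<Rightarrow> real \<Rightarrow> real \<Rightarrow> real" where
  "cert_poly k l r j i =
     (let x = k - j + 1; y = l - j + 1; N = x + y; a = x - 1 - (r - j - 1); b = y - 1 - (r - j - 1)
      in N * (j + 1) * (a + (i - j - 1)) * (b + (i - j - 1))
         + (N - 2) * (N * a * b + (i - j - 1) * (x * y - (r - j) * N)))"

text \<open>Up to a factor common to all three sums, the left side collects the summands of the
  recurrence at \<open>j + 1\<close>, \<open>j\<close> and \<open>j - 1\<close>, and the right side
  is the difference of consecutive values of the function \<open>G\<close> that makes the recurrence
  telescope.\<close>

lemma certificate:
  fixes k l r j i :: real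
  defines "K \<equiv> k - j + 1 - (r - i)" and "L \<equiv> l - j + 1 - (r - i)" and "h \<equiv> k + l - 2 * j"
  shows "(h + 2) * (k + l + 1 - j) * (j + 1) * (K * (K - 1)) * (L * (L - 1))
     + (h * (h + 1) * (h + 2) * r - (h + 2) * (k + l + 1 - j) * (l - j) * (k - j)
          - h * j * (l + 1 - j) * (k + 1 - j)) * ((j + 1 - i) * K * L)
     + h * (k + 1 - j)\<^sup>2 * (l + 1 - j)\<^sup>2 * ((j + 1 - i) * (j - i))
     = (j + 1 - i) * (r - i)\<^sup>2 * cert_poly k l r j (i + 1) + i * K * L * cert_poly k l r j i"
proof -
  define x y s e where "x = k - j + 1" and "y = l - j + 1" and "s = r - i" and "e = j + 1 - i"
  have sub: "k = x + j - 1" "l = y + j - 1" "i = j + 1 - e" "r = s + j + 1 - e"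
    by (simp_all add: x_def y_def s_def e_def)
  define N M J where "N = x + y" and "M = (x - s) * (y - s)" and "J = j + 1"
  define w ab where "w = M + N * s - s * s" and "ab = M + 1 - (N - 2*s) + e * (N-2*s-2) + e*e"
  have w: "w = x * y" and M1: "M + 1 - (N - 2*s) = (x - s - 1) * (y - s - 1)"
    and ab: "ab = (x - 1 - s + e) * (y - 1 - s + e)"
    by (simp_all add: w_def ab_def M_def N_def algebra_simps)
  have P1: "cert_poly k l r j i = N * J * (M + 1 - (N - 2*s)) + (N-2) * (N * ab - e * w - e * (e-1-s) * N)"
    unfolding cert_poly_def Let_def sub ab w M1 unfolding N_def J_def
    by (simp add: algebra_simps)
  have P2: "cert_poly k l r j (i + 1) = N * J * M + (N-2) * (N * ab + (1-e) * (w + (e-1-s)*N))"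
    unfolding cert_poly_def Let_def sub ab w unfolding N_def J_def M_def
    by (simp add: algebra_simps)
  have K: "K = x - s" "L = y - s" "h = N - 2"
    by (simp_all add: K_def L_def h_def x_def y_def s_def N_def)
  have K4: "K * (K - 1) * (L * (L - 1)) = M * (M + 1 - (N - 2*s))"
    unfolding M1 K by (simp only: M_def mult_ac)
  have KL: "K * L = M" unfolding K M_def ..
  have eqs: "k + l + 1 - j = N + J - 2" "(l - j) * (k - j) = w - N + 1" "(l + 1 - j) * (k + 1 - j) = w"
    "j + 1 - i = e" "j - i = e - 1" "h + 2 = N" "h + 1 = N - 1"
    "(k + 1 - j)\<^sup>2 * (l + 1 - j)\<^sup>2 = w * w"
    unfolding w N_def J_def K(3) by (simp_all add: sub algebra_simps power2_eq_square)
  have eqs': "h = N - 2" "j + 1 = J" "r = s + J - e"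
    and J: "j = J - 1" "i = J - e"
    unfolding J_def K(3) by (simp_all add: sub)
  have "(h + 2) * (k + l + 1 - j) * (j + 1) * (K * (K - 1)) * (L * (L - 1))
     + (h * (h + 1) * (h + 2) * r - (h + 2) * (k + l + 1 - j) * (l - j) * (k - j)
          - h * j * (l + 1 - j) * (k + 1 - j)) * ((j + 1 - i) * K * L)
     + h * (k + 1 - j)\<^sup>2 * (l + 1 - j)\<^sup>2 * ((j + 1 - i) * (j - i))
    = (h + 2) * (k + l + 1 - j) * (j + 1) * (K * (K - 1) * (L * (L - 1)))
     + (h * (h + 1) * (h + 2) * r - (h + 2) * (k + l + 1 - j) * ((l - j) * (k - j))
          - h * j * ((l + 1 - j) * (k + 1 - j))) * (j + 1 - i) * (K * L)
     + h * ((k + 1 - j)\<^sup>2 * (l + 1 - j)\<^sup>2) * (j + 1 - i) * (j - i)"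
    by (simp only: mult.assoc)
  also have "\<dots> = N*(N+J-2)*J*(M*(M + 1 - (N - 2*s))) + ((N-2)*(N-1)*N*(s+J-e) - N*(N+J-2)*(w-N+1) - (N-2)*(J-1)*w)*e*M
     + (N-2)*(w*w)*e*(e-1)"
    unfolding eqs K4 KL unfolding eqs' unfolding J(1) ..
  also have "\<dots> = e*(s*s)*cert_poly k l r j (i + 1) + (J-e)*M*cert_poly k l r j i"
    using certificate_reduced[of N J M s e, folded w_def, folded ab_def] unfolding P1 P2
    by (simp add: mult.assoc)
  also have "\<dots> = (j + 1 - i) * (r - i)\<^sup>2 * cert_poly k l r j (i + 1) + i * K * L * cert_poly k l r j i"
    unfolding eqs(4) s_def[symmetric] mult.assoc[of i] KL J(2)[symmetric] power2_eq_square ..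
  finally show ?thesis .
qed

lemma eberlein_eq_sum_rfact:
  assumes "j \<le> k" "j \<le> l"
  shows "eberlein k l r j = (\<Sum>i\<le>r. (- 1) ^ i * (fact j * fact (k - j) * fact (l - j)
      * rfact (int i) * rfact (int j - int i) * (rfact (int r - int i))\<^sup>2
      * rfact (int k - int j - int r + int i) * rfact (int l - int j - int r + int i)))"
  unfolding eberlein_def
proof (rule sum.cong[OF refl])
  fix i assume "i \<in> {..r}"
  then show "(- 1) ^ i * real ((j choose i) * ((k - j) choose (r - i)) * ((l - j) choose (r - i)))
    = (- 1) ^ i * (fact j * fact (k - j) * fact (l - j)
      * rfact (int i) * rfact (int j - int i) * (rfact (int r - int i))\<^sup>2
      * rfact (int k - int j - int r + int i) * rfact (int l - int j - int r + int i))"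
    using assms
    by (simp add: binomial_rfact of_nat_diff power2_eq_square algebra_simps)
qed

text \<open>Up to normalization this is the recurrence of the Hahn polynomials in the degree
  \<open>j\<close>, with \<open>r\<close> as the variable. Termwise the left side is a constant
  times \<open>G i - G (Suc i)\<close>, and \<open>G\<close> vanishes at both ends.\<close>

lemma eberlein_recurrence:
  fixes k l r j :: nat
  assumes j: "0 < j" "j < k" "j < l"
  defines "h \<equiv> real k + real l - 2 * real j"
  defines "\<alpha> \<equiv> (h + 2) * (real k + real l + 1 - real j) * (real l - real j) * (real k - real j)"
    and "\<gamma> \<equiv> h * real j * (real l + 1 - real j) * (real k + 1 - real j)"
  shows "\<alpha> * eberlein k l r (Suc j) + (h * (h + 1) * (h + 2) * real r - \<alpha> - \<gamma>) * eberlein k l r j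
    + \<gamma> * eberlein k l r (j - 1) = 0"
proof -
  \<comment> \<open>Each \<open>rfact\<close> takes the largest argument occurring in the three
    sums; the smaller arguments are then polynomial multiples by
    \<open>rfact_diff_1\<close>.\<close>
  define x0 x1 x2 x3 x4 where "x0 i = rfact (int i)" and "x1 i = rfact (int j + 1 - int i)"
    and "x2 i = rfact (int r - int i)" and "x3 i = rfact (int k - int j - int r + int i + 1)"
    and "x4 i = rfact (int l - int j - int r + int i + 1)" for i :: nat
  define K L where "K i = real k - real j + 1 - (real r - real i)"
    and "L i = real l - real j + 1 - (real r - real i)" for i :: nat
  define c :: real where "c = fact j * fact (k - j) * fact (l - j)"
  \<comment> \<open>\<open>K i * x3 i\<close> and \<open>L i * x4 i\<close> are \<open>rfact\<close>
    at arguments lower by 1. The factor \<open>real i\<close> makes \<open>G 0\<close> vanish, and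
    \<open>x2\<close> makes \<open>G (Suc r)\<close> vanish.\<close>
  define G where "G i = (- 1) ^ i * real i * x0 i * x1 i * (x2 i)\<^sup>2 * (K i * x3 i) * (L i * x4 i)
    * cert_poly k l r j i" for i
  define B where "B i = (- 1) ^ i * c * x0 i * x1 i * (x2 i)\<^sup>2 * x3 i * x4 i" for i
  have K: "of_int (int k - int j - int r + int i + 1) = K i"
    "of_int (int k - int j - int r + int i) = K i - 1"
    "of_int (int l - int j - int r + int i + 1) = L i"
    "of_int (int l - int j - int r + int i) = L i - 1"
    for i by (simp_all add: K_def L_def)
  have shift: "rfact (int k - int j - int r + int i) = K i * x3 i"
    "rfact (int k - int j - int r + int i - 1) = (K i - 1) * (K i * x3 i)"
    "rfact (int l - int j - int r + int i) = L i * x4 i"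
    "rfact (int l - int j - int r + int i - 1) = (L i - 1) * (L i * x4 i)"
    "rfact (int j - int i) = (real j + 1 - real i) * x1 i"
    "rfact (int j - 1 - int i) = (real j - real i) * ((real j + 1 - real i) * x1 i)"
    "rfact (int r - int i - 1) = (real r - real i) * x2 i"
    for i
  proof -
    show k: "rfact (int k - int j - int r + int i) = K i * x3 i"
      unfolding K[symmetric] x3_def by (rule rfact_eq_mult) simp
    show "rfact (int k - int j - int r + int i - 1) = (K i - 1) * (K i * x3 i)"
      using rfact_eq_mult[of "int k - int j - int r + int i - 1" "int k - int j - int r + int i"]
      unfolding K k by simp
    show l: "rfact (int l - int j - int r + int i) = L i * x4 i"
      unfolding K[symmetric] x4_def by (rule rfact_eq_mult) simp
    show "rfact (int l - int j - int r + int i - 1) = (L i - 1) * (L i * x4 i)"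
      using rfact_eq_mult[of "int l - int j - int r + int i - 1" "int l - int j - int r + int i"]
      unfolding K l by simp
    show j: "rfact (int j - int i) = (real j + 1 - real i) * x1 i"
      using rfact_eq_mult[of "int j - int i" "int j + 1 - int i"] by (simp add: x1_def)
    show "rfact (int j - 1 - int i) = (real j - real i) * ((real j + 1 - real i) * x1 i)"
      unfolding j[symmetric] using rfact_eq_mult[of "int j - 1 - int i" "int j - int i"] by simp
    show "rfact (int r - int i - 1) = (real r - real i) * x2 i"
      using rfact_eq_mult[of "int r - int i - 1" "int r - int i"] by (simp add: x2_def)
  qed
  have G_Suc: "G (Suc i) = - ((- 1) ^ i * x0 i * ((real j + 1 - real i) * x1 i) * ((real r - real i) * x2 i)\<^sup>2
      * x3 i * x4 i * cert_poly k l r j (real i + 1))" for i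
  proof -
    have "real (Suc i) * x0 (Suc i) = x0 i"
      using rfact_diff_1[of "int (Suc i)"] by (simp add: x0_def)
    moreover have "x1 (Suc i) = (real j + 1 - real i) * x1 i" "x2 (Suc i) = (real r - real i) * x2 i"
      using shift(5,7)[of i] by (simp_all add: x1_def x2_def algebra_simps)
    moreover have "K (Suc i) * x3 (Suc i) = x3 i" "L (Suc i) * x4 (Suc i) = x4 i"
      using shift(1,3)[of "Suc i"] by (simp_all add: x3_def x4_def algebra_simps)
    ultimately show ?thesis
      unfolding G_def by (simp add: mult.assoc add.commute)
  qed
  \<comment> \<open>The factors \<open>l - j\<close> and \<open>k - j\<close> of
    \<open>\<alpha>\<close> absorb the change of the factorial prefactor from \<open>j\<close> to
    \<open>Suc j\<close>; \<open>c_pred\<close> does the same for \<open>\<gamma>\<close> and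
    \<open>j - 1\<close>.\<close>
  have c_Suc: "(real l - real j) * (real k - real j) * (fact (Suc j) * fact (k - Suc j) * fact (l - Suc j))
     = (real j + 1) * c"
  proof -
    obtain k' l' where "k = j + 1 + k'" "l = j + 1 + l'"
      using j by (metis less_iff_Suc_add Suc_eq_plus1 add.assoc add.commute)
    then show ?thesis unfolding c_def by (simp add: algebra_simps)
  qed
  have c_pred: "real j * (fact (j - 1) * fact (k - (j - 1)) * fact (l - (j - 1)))
     = (real l + 1 - real j) * (real k + 1 - real j) * c"
  proof -
    obtain j' where "j = Suc j'" using j by (cases j) auto
    moreover obtain k' l' where "k = j + 1 + k'" "l = j + 1 + l'"
      using j by (metis less_iff_Suc_add Suc_eq_plus1 add.assoc add.commute)
    ultimately show ?thesis unfolding c_def by (simp add: Suc_diff_le algebra_simps)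
  qed
  have plus: "\<alpha> * eberlein k l r (Suc j) = (\<Sum>i\<le>r. B i * ((h + 2) * (real k + real l + 1 - real j)
      * (real j + 1) * (K i * (K i - 1)) * (L i * (L i - 1))))"
    (is "_ = sum ?f _")
  proof -
    have "\<alpha> * ((- 1) ^ i * (fact (Suc j) * fact (k - Suc j) * fact (l - Suc j)
      * rfact (int i) * rfact (int (Suc j) - int i) * (rfact (int r - int i))\<^sup>2
      * rfact (int k - int (Suc j) - int r + int i) * rfact (int l - int (Suc j) - int r + int i)))
      = ?f i" for i
    proof -
      have r: "rfact (int k - int (Suc j) - int r + int i) = (K i - 1) * (K i * x3 i)"
        "rfact (int l - int (Suc j) - int r + int i) = (L i - 1) * (L i * x4 i)"
        "rfact (int (Suc j) - int i) = x1 i"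
        using shift(2,4)[of i] by (simp_all add: algebra_simps x1_def)
      have "\<alpha> * ((- 1) ^ i * (fact (Suc j) * fact (k - Suc j) * fact (l - Suc j)
      * rfact (int i) * rfact (int (Suc j) - int i) * (rfact (int r - int i))\<^sup>2
      * rfact (int k - int (Suc j) - int r + int i) * rfact (int l - int (Suc j) - int r + int i)))
       = (h + 2) * (real k + real l + 1 - real j) * (- 1) ^ i *
         ((real l - real j) * (real k - real j) * (fact (Suc j) * fact (k - Suc j) * fact (l - Suc j)))
         * x0 i * x1 i * (x2 i)\<^sup>2 * ((K i - 1) * (K i * x3 i)) * ((L i - 1) * (L i * x4 i))"
        unfolding \<alpha>_def r x0_def x2_def by (simp only: mult_ac)
      then show ?thesis unfolding c_Suc B_def by (simp only: mult_ac)
    qed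
    then show ?thesis
      using j by (simp add: eberlein_eq_sum_rfact sum_distrib_left del: fact_Suc of_nat_Suc)
  qed
  have mid: "eberlein k l r j = (\<Sum>i\<le>r. B i * ((real j + 1 - real i) * K i * L i))"
    using j by (simp add: eberlein_eq_sum_rfact B_def c_def shift x0_def x2_def mult_ac)
  have minus: "\<gamma> * eberlein k l r (j - 1) = (\<Sum>i\<le>r. B i * (h * (real k + 1 - real j)\<^sup>2 *
      (real l + 1 - real j)\<^sup>2 * ((real j + 1 - real i) * (real j - real i))))"
    (is "_ = sum ?f _")
  proof -
    have "\<gamma> * ((- 1) ^ i * (fact (j - 1) * fact (k - (j - 1)) * fact (l - (j - 1))
      * rfact (int i) * rfact (int (j - 1) - int i) * (rfact (int r - int i))\<^sup>2
      * rfact (int k - int (j - 1) - int r + int i) * rfact (int l - int (j - 1) - int r + int i)))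
      = ?f i" for i
    proof -
      have r: "rfact (int k - int (j - 1) - int r + int i) = x3 i"
        "rfact (int l - int (j - 1) - int r + int i) = x4 i"
        "rfact (int (j - 1) - int i) = (real j - real i) * ((real j + 1 - real i) * x1 i)"
        using shift(6)[of i] j by (simp_all add: algebra_simps x3_def x4_def of_nat_diff)
      have "\<gamma> * ((- 1) ^ i * (fact (j - 1) * fact (k - (j - 1)) * fact (l - (j - 1))
      * rfact (int i) * rfact (int (j - 1) - int i) * (rfact (int r - int i))\<^sup>2
      * rfact (int k - int (j - 1) - int r + int i) * rfact (int l - int (j - 1) - int r + int i)))
       = h * (real l + 1 - real j) * (real k + 1 - real j) * (- 1) ^ i *
         (real j * (fact (j - 1) * fact (k - (j - 1)) * fact (l - (j - 1))))
         * x0 i * ((real j - real i) * ((real j + 1 - real i) * x1 i)) * (x2 i)\<^sup>2 * x3 i * x4 i"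
        unfolding \<gamma>_def r x0_def x2_def by (simp only: mult_ac)
      then show ?thesis unfolding c_pred B_def by (simp only: mult_ac power2_eq_square)
    qed
    then show ?thesis
      using j by (simp add: eberlein_eq_sum_rfact sum_distrib_left del: fact_Suc of_nat_Suc)
  qed
  have "\<alpha> * eberlein k l r (Suc j) + (h * (h + 1) * (h + 2) * real r - \<alpha> - \<gamma>) * eberlein k l r j
    + \<gamma> * eberlein k l r (j - 1)
    = (\<Sum>i\<le>r. c * (G i - G (Suc i)))"
    unfolding plus mid minus sum_distrib_left sum.distrib[symmetric]
  proof (rule sum.cong[OF refl])
    fix i
    have "B i * ((h + 2) * (real k + real l + 1 - real j) * (real j + 1) * (K i * (K i - 1)) * (L i * (L i - 1)))
      + (h * (h + 1) * (h + 2) * real r - \<alpha> - \<gamma>) * (B i * ((real j + 1 - real i) * K i * L i))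
      + B i * (h * (real k + 1 - real j)\<^sup>2 * (real l + 1 - real j)\<^sup>2 * ((real j + 1 - real i) * (real j - real i)))
      = B i * ((h + 2) * (real k + real l + 1 - real j) * (real j + 1) * (K i * (K i - 1)) * (L i * (L i - 1))
      + (h * (h + 1) * (h + 2) * real r - \<alpha> - \<gamma>) * ((real j + 1 - real i) * K i * L i)
      + h * (real k + 1 - real j)\<^sup>2 * (real l + 1 - real j)\<^sup>2 * ((real j + 1 - real i) * (real j - real i)))"
      by (simp only: distrib_left mult_ac)
    also have "\<dots> = B i * ((real j + 1 - real i) * (real r - real i)\<^sup>2 * cert_poly k l r j (real i + 1)
      + real i * K i * L i * cert_poly k l r j i)"
      unfolding \<alpha>_def \<gamma>_def h_def K_def L_def
      by (rule arg_cong[where f = "(*) (B i)"], rule certificate)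
    also have "\<dots> = c * (G i - G (Suc i))"
      unfolding G_Suc unfolding B_def G_def by (simp add: algebra_simps power2_eq_square)
    finally show "B i * ((h + 2) * (real k + real l + 1 - real j) * (real j + 1) * (K i * (K i - 1)) * (L i * (L i - 1)))
      + (h * (h + 1) * (h + 2) * real r - \<alpha> - \<gamma>) * (B i * ((real j + 1 - real i) * K i * L i))
      + B i * (h * (real k + 1 - real j)\<^sup>2 * (real l + 1 - real j)\<^sup>2 * ((real j + 1 - real i) * (real j - real i)))
      = c * (G i - G (Suc i))" .
  qed
  also have "\<dots> = c * (\<Sum>i<Suc r. G i - G (Suc i))"
    by (simp only: sum_distrib_left lessThan_Suc_atMost)
  also have "(\<Sum>i<Suc r. G i - G (Suc i)) = G 0 - G (Suc r)"
    by (rule sum_lessThan_telescope')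
  also have "G 0 = 0" by (simp add: G_def)
  also have "G (Suc r) = 0" by (simp add: G_def x2_def)
  finally show ?thesis by simp
qed

section \<open>Values at \<open>j = 0, 1, 2\<close> and propagation along the recurrence\<close>

lemma eberlein_commute: "eberlein k l r j = eberlein l k r j"
  by (simp add: eberlein_def mult_ac)

lemma eberlein_0: "eberlein k l r 0 = real ((k choose r) * (l choose r))"
proof -
  have "eberlein k l r 0 = (\<Sum>i\<in>{0}. (- 1) ^ i * real ((0 choose i) * ((k - 0) choose (r - i)) * ((l - 0) choose (r - i))))"
    unfolding eberlein_def by (rule sum.mono_neutral_right) (auto simp: binomial_eq_0)
  then show ?thesis by simp
qed

text \<open>Only \<open>i = 0\<close> and \<open>i = 1\<close> contribute, and absorption relates
  both to the binomials of \<open>eberlein k l r 0\<close>. When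
  \<open>r * (k + l - 1) = k * l\<close>, the factor on the right is \<open>- r\<close>, so the
  value is exactly \<open>- eberlein k l r 0 / (k + l - 1)\<close>.\<close>

lemma eberlein_1:
  assumes "0 < r" "r \<le> k" "r \<le> l"
  shows "real (k * l) * eberlein k l r 1
    = (real (k * l) - real r * real (k + l)) * eberlein k l r 0"
proof -
  obtain r' k' l' where S: "r = Suc r'" "k = Suc k'" "l = Suc l'"
    using assms by (metis Suc_pred less_le_trans)
  have "eberlein k l r 1 = (\<Sum>i\<in>{0,1}. (- 1) ^ i * real ((1 choose i) * ((k - 1) choose (r - i)) * ((l - 1) choose (r - i))))"
    unfolding eberlein_def using assms(1)
    by (intro sum.mono_neutral_right) (auto intro!: binomial_eq_0)
  then have E: "eberlein k l r 1 = real (k' choose r) * real (l' choose r) - real (k' choose r') * real (l' choose r')"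
    by (simp add: S)
  have absorb: "real (Suc a) * real (a choose r') = real r * real (Suc a choose r)"
    "real (Suc a) * real (a choose r) = (real (Suc a) - real r) * real (Suc a choose r)" for a
  proof -
    have "Suc a * (a choose r') = r * (Suc a choose r)"
      unfolding S(1) by (metis Suc_times_binomial mult.commute)
    then show 1: "real (Suc a) * real (a choose r') = real r * real (Suc a choose r)"
      by (metis of_nat_mult)
    have "real (Suc a choose r) = real (a choose r') + real (a choose r)"
      by (simp add: S)
    then show "real (Suc a) * real (a choose r) = (real (Suc a) - real r) * real (Suc a choose r)"
      using 1 by Groebner_Basis.algebra
  qed
  have "real (k * l) * eberlein k l r 1
      = (real k * real (k' choose r)) * (real l * real (l' choose r))
        - (real k * real (k' choose r')) * (real l * real (l' choose r'))"
    unfolding E of_nat_mult by (simp only: right_diff_distrib mult_ac)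
  also have "\<dots> = ((real k - real r) * (real l - real r) - real r * real r) * (real (k choose r) * real (l choose r))"
    unfolding absorb(1)[of k', folded S(2)] absorb(1)[of l', folded S(3)]
      absorb(2)[of k', folded S(2)] absorb(2)[of l', folded S(3)]
    by Groebner_Basis.algebra
  also have "\<dots> = (real (k * l) - real r * real (k + l)) * eberlein k l r 0"
    unfolding eberlein_0 by (simp add: algebra_simps)
  finally show ?thesis .
qed

text \<open>In the recurrence the coefficients \<open>\<beta>\<close> and \<open>\<gamma>\<close>
  are nonnegative, and \<open>cond\<close> amounts to
  \<open>\<beta> + \<gamma> \<le> \<alpha>\<close>; so a bound on two consecutive values passes to
  the next one. \<open>\<delta>\<close> and \<open>\<epsilon>\<close> measure the deviation from
  \<open>n = 4 * r\<close> and from \<open>k = l\<close>.\<close>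

lemma eberlein_step:
  fixes k l r j :: nat
  assumes j: "0 < j" "j < k" "j < l"
  defines "n \<equiv> real k + real l"
  defines "h \<equiv> n - 2 * real j" and "\<delta> \<equiv> 4 * real r - n" and "\<epsilon> \<equiv> (real k - real l)\<^sup>2"
  assumes \<delta>: "\<delta> \<ge> 0"
    and cond: "h * (h + 1) * (h - \<delta>) \<ge> 2 * real j * h + 2 * \<epsilon> * (h + 1 + real j)"
    and B: "\<bar>eberlein k l r j\<bar> \<le> B" "\<bar>eberlein k l r (j - 1)\<bar> \<le> B"
  shows "\<bar>eberlein k l r (Suc j)\<bar> \<le> B"
proof -
  define x :: real where "x = real j"
  have n: "n = h + 2 * x" unfolding h_def x_def by simp
  have h: "h > 0" and x: "x > 0" using j unfolding h_def n_def x_def by simp_all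
  have eps: "\<epsilon> \<ge> 0" unfolding \<epsilon>_def by simp
  define \<alpha> \<gamma> \<beta> where "\<alpha> = (h + 2) * (real k + real l + 1 - real j) * (real l - real j) * (real k - real j)"
    and "\<gamma> = h * real j * (real l + 1 - real j) * (real k + 1 - real j)"
    and "\<beta> = h * (h + 1) * (h + 2) * real r - \<alpha> - \<gamma>"
  have recurrence: "\<alpha> * eberlein k l r (Suc j) + \<beta> * eberlein k l r j + \<gamma> * eberlein k l r (j - 1) = 0"
    unfolding \<beta>_def \<alpha>_def \<gamma>_def h_def n_def by (rule eberlein_recurrence[OF j])
  \<comment> \<open>These products turn \<open>\<alpha>\<close>, \<open>\<beta>\<close>,
    \<open>\<gamma>\<close> into polynomials in \<open>h\<close>, \<open>x\<close>,
    \<open>\<delta>\<close>, \<open>\<epsilon>\<close> alone.\<close>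
  have prod: "4 * ((real l - x) * (real k - x)) = h\<^sup>2 - \<epsilon>"
    "4 * ((real l + 1 - x) * (real k + 1 - x)) = (h + 2)\<^sup>2 - \<epsilon>"
    unfolding \<epsilon>_def h_def n_def x_def by (simp_all add: power2_eq_square algebra_simps)
  have m1: "real k + real l + 1 - real j = h + 1 + x"
    using n unfolding n_def x_def by simp
  have \<alpha>4: "4 * \<alpha> = (h + 2) * (h + 1 + x) * (h\<^sup>2 - \<epsilon>)"
    unfolding \<alpha>_def m1 prod(1)[symmetric] by (simp add: x_def)
  have \<gamma>4: "4 * \<gamma> = h * x * ((h + 2)\<^sup>2 - \<epsilon>)"
    unfolding \<gamma>_def prod(2)[symmetric] by (simp add: x_def)
  have r: "4 * real r = h + 2 * x + \<delta>"
    unfolding \<delta>_def n by simp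
  have "4 * \<beta> = h * (h + 1) * (h + 2) * (4 * real r) - 4 * \<alpha> - 4 * \<gamma>"
    unfolding \<beta>_def by simp
  also have "\<dots> = h * (h + 1) * (h + 2) * \<delta> + \<epsilon> * ((h + 1 + x) * (h + 2) + x * h)"
    unfolding \<alpha>4 \<gamma>4 r by Groebner_Basis.algebra
  finally have \<beta>4: "4 * \<beta> = \<dots>" .
  have "\<beta> \<ge> 0"
  proof -
    have "h * (h + 1) * (h + 2) * \<delta> + \<epsilon> * ((h + 1 + x) * (h + 2) + x * h) \<ge> 0"
      using h x \<delta> eps by simp
    then show ?thesis using \<beta>4 by linarith
  qed
  have "\<gamma> \<ge> 0" "\<alpha> > 0"
    unfolding \<alpha>_def \<gamma>_def using h j by auto
  have "4 * \<alpha> - 4 * \<beta> - 4 * \<gamma> = (h + 2) * (h * (h + 1) * (h - \<delta>) - (2 * x * h + 2 * \<epsilon> * (h + 1 + x)))"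
    unfolding \<alpha>4 \<beta>4 \<gamma>4 by (simp add: power2_eq_square algebra_simps)
  also have "\<dots> \<ge> 0"
    using cond h unfolding x_def by (intro mult_nonneg_nonneg) simp_all
  finally have le: "\<beta> + \<gamma> \<le> \<alpha>" by simp
  have "\<alpha> * eberlein k l r (Suc j) = - (\<beta> * eberlein k l r j + \<gamma> * eberlein k l r (j - 1))"
    using recurrence by linarith
  then have "\<alpha> * \<bar>eberlein k l r (Suc j)\<bar> = \<bar>\<beta> * eberlein k l r j + \<gamma> * eberlein k l r (j - 1)\<bar>"
    using \<open>\<alpha> > 0\<close> by (metis abs_minus_cancel abs_mult abs_of_pos)
  also have "\<dots> \<le> \<beta> * \<bar>eberlein k l r j\<bar> + \<gamma> * \<bar>eberlein k l r (j - 1)\<bar>"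
    using \<open>\<beta> \<ge> 0\<close> \<open>\<gamma> \<ge> 0\<close> by (metis abs_mult abs_of_nonneg abs_triangle_ineq)
  also have "\<dots> \<le> \<beta> * B + \<gamma> * B"
    using \<open>\<beta> \<ge> 0\<close> \<open>\<gamma> \<ge> 0\<close> B by (intro add_mono mult_left_mono)
  also have "\<dots> \<le> \<alpha> * B"
    using le B(1) by (metis abs_ge_zero distrib_right mult_right_mono order_trans)
  finally show ?thesis using \<open>\<alpha> > 0\<close> by simp
qed

text \<open>Assumption \<open>kl\<close> makes the values at 1 and 2 equal to minus the bound; from
  there \<open>eberlein_step\<close> carries it up to \<open>J\<close>.\<close>

lemma eberlein_small_index:
  fixes k l r J :: nat
  assumes r: "0 < r" "r \<le> k" "r \<le> l" and n: "k + l \<le> 4 * r"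
    and kl: "real r * (real (k + l) - 1) = real (k * l)"
    and cond: "\<And>j h. 2 \<le> j \<Longrightarrow> j < J \<Longrightarrow> j < k \<Longrightarrow> j < l \<Longrightarrow> h = real (k + l) - 2 * real j \<Longrightarrow>
      h * (h + 1) * (h - (4 * real r - real (k + l))) \<ge> 2 * real j * h + 2 * (real k - real l)\<^sup>2 * (h + 1 + real j)"
    and j: "1 \<le> j" "j \<le> J" "j \<le> k" "j \<le> l"
  shows "\<bar>eberlein k l r j\<bar> * (real (k + l) - 1) \<le> eberlein k l r 0"
proof -
  define n :: real where "n = real (k + l)"
  define d where "d = eberlein k l r 0"
  have n1: "n - 1 > 0" using r unfolding n_def by simp
  have d: "d \<ge> 0" unfolding d_def eberlein_0 by simp
  have E1: "eberlein k l r 1 * (n - 1) = - d"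
  proof -
    have "real r * (n - 1) * eberlein k l r 1 = - real r * d"
      using eberlein_1[OF r] unfolding kl[symmetric] n_def[symmetric] d_def[symmetric]
      by (simp add: algebra_simps)
    then have "real r * (eberlein k l r 1 * (n - 1)) = real r * (- d)"
      by (simp add: mult_ac)
    then show ?thesis using r by (simp only: mult_cancel_left) simp
  qed
  have E2: "eberlein k l r 2 * (n - 1) = - d" if "1 < k" "1 < l"
  proof -
    define a where "a = n * n * (real l - 1) * (real k - 1)"
    have h: "real k + real l - 2 * real 1 + 2 = n" "real k + real l + 1 - real 1 = n"
      "real k + real l - 2 * real 1 = n - 2" "real k + real l - 2 * real 1 + 1 = n - 1"
      unfolding n_def by simp_all
    have rec: "a * eberlein k l r 2 + ((n - 2) * (n - 1) * n * real r - a - (n - 2) * (real l * real k)) * eberlein k l r 1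
      + (n - 2) * (real l * real k) * d = 0"
      using eberlein_recurrence[of 1 k l r] that unfolding h a_def d_def numeral_2_eq_2
      by (simp add: mult.assoc)
    have kl': "real l * real k = real r * (n - 1)"
      using kl unfolding n_def by (simp add: mult.commute)
    \<comment> \<open>With \<open>E1\<close> and \<open>kl'\<close> inserted into the recurrence at
      \<open>j = 1\<close>, all terms free of \<open>a\<close> cancel.\<close>
    have "a * (eberlein k l r 2 * (n - 1)) = a * (- d)"
      using rec E1 kl' by Groebner_Basis.algebra
    moreover have "a > 0" using that unfolding a_def n_def by simp
    ultimately show ?thesis by (simp only: mult_cancel_left) simp
  qed
  define B where "B = d / (n - 1)"
  have B: "\<bar>y\<bar> \<le> B \<longleftrightarrow> \<bar>y\<bar> * (n - 1) \<le> d" for y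
    unfolding B_def using n1 by (simp add: field_simps)
  \<comment> \<open>The step needs two consecutive bounds. At \<open>j = 1\<close> the predecessor
    is the large value \<open>d\<close>, hence the exception; the value at 2 comes from
    \<open>E2\<close> instead.\<close>
  have "\<bar>eberlein k l r j\<bar> \<le> B \<and> (j \<noteq> 1 \<longrightarrow> \<bar>eberlein k l r (j - 1)\<bar> \<le> B)"
    using j
  proof (induction j rule: dec_induct)
    case base
    have "\<bar>eberlein k l r 1\<bar> * (n - 1) = \<bar>- d\<bar>"
      unfolding E1[symmetric] abs_mult using n1 by simp
    then show ?case unfolding B using d by simp
  next
    case (step j)
    then have IH: "\<bar>eberlein k l r j\<bar> \<le> B" "j \<noteq> 1 \<Longrightarrow> \<bar>eberlein k l r (j - 1)\<bar> \<le> B"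
      and j: "j < k" "j < l" "j < J" by auto
    have "\<bar>eberlein k l r (Suc j)\<bar> \<le> B"
    proof (cases "j = 1")
      case True
      then have "\<bar>eberlein k l r (Suc j)\<bar> * (n - 1) = \<bar>- d\<bar>"
        unfolding E2[symmetric, OF j(1,2)[unfolded True]] abs_mult using n1 by (simp add: numeral_2_eq_2)
      then show ?thesis unfolding B using d by simp
    next
      case False
      with step have "2 \<le> j" by simp
      show ?thesis
        using cond[OF \<open>2 \<le> j\<close> j(3) j(1,2) refl] IH(1) IH(2)[OF False] \<open>2 \<le> j\<close> j n
        by (intro eberlein_step) simp_all
    qed
    with IH show ?case by simp
  qed
  then show ?thesis unfolding B by (simp add: n_def d_def)
qed

section \<open>Triangle inequality for large \<open>j\<close> and binomial estimates\<close>

lemma binomial_le_binomial_add: "a choose b \<le> (a + c) choose (b + c)"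
  by (induction c) (auto intro: order_trans)

text \<open>Once the signs are dropped, Vandermonde sums the first two binomials to
  \<open>k choose r\<close>, so it suffices to bound the third one by
  \<open>(l choose r) / c\<close>. Monotonicity of binomials reduces this from \<open>j\<close> to
  \<open>J\<close>, where \<open>table\<close> provides it.\<close>

lemma eberlein_large_index:
  fixes k l r J :: nat
  assumes table: "\<And>i. i \<le> r \<Longrightarrow> i \<le> J \<Longrightarrow> real ((l - J) choose (r - i)) * c \<le> real (l choose r)"
    and c: "0 \<le> c" and j: "J \<le> j" "j \<le> k" "j \<le> l"
  shows "\<bar>eberlein k l r j\<bar> * c \<le> eberlein k l r 0"
proof -
  have mono: "real ((l - j) choose (r - i)) * c \<le> real (l choose r)" if i: "i \<le> r" "i \<le> j" for i
  proof -
    \<comment> \<open>For \<open>i > J\<close> the binomial is raised along the diagonal until it is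
      dominated by the table entry at \<open>J\<close>.\<close>
    define i0 where "i0 = min i J"
    have "(l - j) choose (r - i) \<le> (l - J) choose (r - i0)"
    proof -
      have "(l - j) choose (r - i) \<le> ((l - j) + (i - i0)) choose ((r - i) + (i - i0))"
        by (rule binomial_le_binomial_add)
      also have "\<dots> \<le> (l - J) choose ((r - i) + (i - i0))"
        by (rule binomial_right_mono) (use i j in \<open>auto simp: i0_def\<close>)
      also have "(r - i) + (i - i0) = r - i0"
        using i by (auto simp: i0_def)
      finally show ?thesis .
    qed
    then have "real ((l - j) choose (r - i)) * c \<le> real ((l - J) choose (r - i0)) * c"
      using c by (intro mult_right_mono) simp_all
    also have "\<dots> \<le> real (l choose r)"
      by (rule table) (use i in \<open>auto simp: i0_def\<close>)
    finally show ?thesis .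
  qed
  have "\<bar>eberlein k l r j\<bar> * c \<le> (\<Sum>i\<le>r. real ((j choose i) * ((k - j) choose (r - i)) * ((l - j) choose (r - i)))) * c"
    unfolding eberlein_def using c
    by (intro mult_right_mono order_trans[OF sum_abs] sum_mono) (simp_all add: abs_mult)
  also have "\<dots> = (\<Sum>i\<le>r. real ((j choose i) * ((k - j) choose (r - i))) * (real ((l - j) choose (r - i)) * c))"
    unfolding sum_distrib_right by (simp add: mult_ac)
  also have "\<dots> \<le> (\<Sum>i\<le>r. real ((j choose i) * ((k - j) choose (r - i))) * real (l choose r))"
  proof (rule sum_mono)
    fix i assume "i \<in> {..r}"
    then show "real ((j choose i) * ((k - j) choose (r - i))) * (real ((l - j) choose (r - i)) * c)
      \<le> real ((j choose i) * ((k - j) choose (r - i))) * real (l choose r)"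
      using mono[of i] by (cases "i \<le> j") (auto intro!: mult_left_mono simp: binomial_eq_0)
  qed
  also have "\<dots> = real (\<Sum>i\<le>r. (j choose i) * ((k - j) choose (r - i))) * real (l choose r)"
    by (simp only: sum_distrib_right of_nat_sum)
  also have "(\<Sum>i\<le>r. (j choose i) * ((k - j) choose (r - i))) = k choose r"
    using vandermonde[of j "k - j" r] j by simp
  finally show ?thesis by (simp add: eberlein_0)
qed

text \<open>Lowering both entries by one multiplies the binomial by \<open>r / N\<close>, at most
  \<open>1 / \<rho>\<close>; the ratio condition survives because
  \<open>\<rho> \<ge> 1\<close>.\<close>

lemma binomial_power_bound_lower:
  fixes \<rho> :: real
  assumes "1 \<le> \<rho>" "i \<le> r" "i \<le> N" "real r * \<rho> \<le> real N"
  shows "real ((N - i) choose (r - i)) * \<rho> ^ i \<le> real (N choose r)"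
  using assms(2-4)
proof (induction i arbitrary: r N)
  case (Suc i)
  then obtain r' N' where S: "r = Suc r'" "N = Suc N'"
    by (metis Suc_le_D)
  have "real ((N' - i) choose (r' - i)) * \<rho> ^ i \<le> real (N' choose r')"
    by (rule Suc.IH) (use Suc.prems assms(1) in \<open>auto simp: S algebra_simps\<close>)
  then have "real ((N' - i) choose (r' - i)) * \<rho> ^ i * \<rho> \<le> real (N' choose r') * \<rho>"
    using assms(1) by (intro mult_right_mono) simp_all
  also have "\<dots> \<le> real (N choose r)"
  proof -
    have "real N * (real (N' choose r') * \<rho>) = real (N choose r) * (real r * \<rho>)"
      using arg_cong[OF Suc_times_binomial[of r' N'], of real] unfolding S of_nat_mult
      by (simp only: mult_ac)
    also have "\<dots> \<le> real (N choose r) * real N"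
      by (rule mult_left_mono) (use Suc.prems in simp_all)
    finally have "real N * (real (N' choose r') * \<rho>) \<le> real N * real (N choose r)"
      by (simp only: mult.commute)
    then show ?thesis by (rule mult_left_le_imp_le) (simp add: S)
  qed
  finally show ?case by (simp add: S mult_ac)
qed simp

text \<open>Lowering only the upper entry multiplies the binomial by \<open>(N - r) / N\<close>,
  again at most \<open>1 / \<rho>\<close>.\<close>

lemma binomial_power_bound_upper:
  fixes \<rho> :: real
  assumes "1 \<le> \<rho>" "i \<le> N" "(real N - real r) * \<rho> \<le> real N"
  shows "real ((N - i) choose r) * \<rho> ^ i \<le> real (N choose r)"
  using assms(2-3)
proof (induction i arbitrary: N)
  case (Suc i)
  then obtain N' where S: "N = Suc N'"
    by (metis Suc_le_D)
  have "real ((N' - i) choose r) * \<rho> ^ i \<le> real (N' choose r)"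
    by (rule Suc.IH) (use Suc.prems assms(1) in \<open>auto simp: S algebra_simps\<close>)
  then have "real ((N' - i) choose r) * \<rho> ^ i * \<rho> \<le> real (N' choose r) * \<rho>"
    using assms(1) by (intro mult_right_mono) simp_all
  also have "\<dots> \<le> real (N choose r)"
  proof (cases "r \<le> N")
    case True
    have "(N - r) * (N choose r) = N * (N' choose r)"
      using binomial_absorb_comp[of N r] unfolding S by simp
    from arg_cong[OF this, of real] have "real N * (real (N' choose r) * \<rho>) = real (N choose r) * ((real N - real r) * \<rho>)"
      using True by (simp add: of_nat_diff mult_ac)
    also have "\<dots> \<le> real (N choose r) * real N"
      by (rule mult_left_mono) (use Suc.prems in simp_all)
    finally have "real N * (real (N' choose r) * \<rho>) \<le> real N * real (N choose r)"
      by (simp only: mult.commute)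
    then show ?thesis by (rule mult_left_le_imp_le) (simp add: S)
  qed (simp add: S binomial_eq_0)
  finally show ?case by (simp add: S mult_ac)
qed simp

text \<open>From \<open>N choose r\<close> one gets to \<open>(N - J) choose (r - i)\<close> by
  lowering both entries \<open>i\<close> times and only the upper one \<open>J - i\<close> times. As
  \<open>2 * t \<le> J + 1\<close>, one of the two kinds occurs at least \<open>t\<close> times and
  gains \<open>\<rho>\<close> each time; the other kind is estimated by monotonicity.\<close>

lemma binomial_power_bound:
  fixes \<rho> :: real
  assumes \<rho>: "1 \<le> \<rho>" and i: "i \<le> r" "i \<le> J" "J \<le> N"
    and ratio: "real r * \<rho> \<le> real N" "(real N - real r) * \<rho> \<le> real N"
    and t: "2 * t \<le> J + 1"
  shows "real ((N - J) choose (r - i)) * \<rho> ^ t \<le> real (N choose r)"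
proof (cases "t \<le> i")
  case True
  have "real ((N - J) choose (r - i)) * \<rho> ^ t \<le> real ((N - i) choose (r - i)) * \<rho> ^ i"
    using True i \<rho> by (intro mult_mono power_increasing) (auto intro!: binomial_right_mono)
  also have "\<dots> \<le> real (N choose r)"
    using i \<rho> ratio by (intro binomial_power_bound_lower) auto
  finally show ?thesis .
next
  case False
  then have "t \<le> J - i" using t by simp
  have "(N - J) choose (r - i) \<le> ((N - J) + i) choose ((r - i) + i)"
    by (rule binomial_le_binomial_add)
  then have "real ((N - J) choose (r - i)) * \<rho> ^ t \<le> real ((N - (J - i)) choose r) * \<rho> ^ (J - i)"
    using \<open>t \<le> J - i\<close> i \<rho> by (intro mult_mono power_increasing) auto
  also have "\<dots> \<le> real (N choose r)"
    using i \<rho> ratio by (intro binomial_power_bound_upper) auto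
  finally show ?thesis .
qed

section \<open>The bound for the possible parameter families\<close>

text \<open>The left side is \<open>4 * m - 2\<close>, that is \<open>k + l - 1\<close> for
  \<open>k = 2 * m - 1\<close> and \<open>l = 2 * m\<close>, at
  \<open>m + 3 = 2 * t\<close>.\<close>

lemma two_power_ge: "5 \<le> t \<Longrightarrow> 8 * real t - 14 \<le> 2 ^ t"
  by (induction t rule: dec_induct) (auto simp: field_simps)

lemma nine_fifths_power_ge: "8 \<le> t \<Longrightarrow> 8 * real t \<le> (9 / 5) ^ t"
proof (induction t rule: dec_induct)
  case (step t)
  have "8 * real (Suc t) \<le> 9 / 5 * (8 * real t)" using step by simp
  also have "\<dots> \<le> 9 / 5 * (9 / 5) ^ t" using step.IH by (intro mult_left_mono) simp_all
  finally show ?case by simp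
qed (simp add: power_divide)

text \<open>In the next two lemmas the step condition of the recurrence holds below \<open>J\<close>, and the
  triangle inequality is good enough from \<open>J\<close> on.\<close>

lemma eberlein_bound_hadamard:
  fixes m j :: nat
  assumes j: "1 \<le> j" "j \<le> 2 * m - 1" and m: "0 < m"
  defines "k \<equiv> 2 * m - 1" and "l \<equiv> 2 * m"
  shows "\<bar>eberlein k l m j\<bar> * (real (k + l) - 1) \<le> eberlein k l m 0"
proof -
  \<comment> \<open>For \<open>m \<le> 2\<close> this exceeds every index, so the recurrence alone
    suffices; for \<open>m\<close> from 3 to 5 the binomials needed from \<open>J\<close> on are
    evaluated. In general \<open>i < J\<close> keeps \<open>2 * i \<le> h + 9\<close>.\<close>
  define J where "J = (if m \<le> 3 then 4 else if m \<le> 5 then 5 else m + 3)"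
  have kl: "real k = 2 * real m - 1" "real l = 2 * real m"
    using m by (simp_all add: k_def l_def of_nat_diff)
  show ?thesis
  proof (cases "j \<le> J")
    case True
    show ?thesis
    proof (rule eberlein_small_index[where J = J])
      fix i :: nat and h :: real
      assume i: "2 \<le> i" "i < J" "i < k" and h: "h = real (k + l) - 2 * real i"
      have h': "h = 4 * real m - 1 - 2 * real i" and \<delta>: "4 * real m - real (k + l) = 1"
        and \<epsilon>: "(real k - real l)\<^sup>2 = 1"
        unfolding h of_nat_add kl by simp_all
      have "2 * real i * h + 2 * (h + 1 + real i) \<le> h * (h + 1) * (h - 1)"
      \<comment> \<open>For \<open>m = 2\<close> the only index gives \<open>h = 3\<close>, below
        the estimate \<open>h \<ge> 5\<close> used otherwise.\<close>
      proof (cases "m = 2")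
        case True
        then have "i = 2" using i by (simp add: k_def)
        then show ?thesis unfolding h' True by simp
      next
        case False
        with i have m3: "3 \<le> m" by (simp add: k_def)
        have "2 * i \<le> (4 * m - 1 - 2 * i) + 9" "4 * m - 1 \<ge> 2 * i + 5"
          using i m3 unfolding J_def k_def by (auto split: if_splits)
        then have i9: "2 * real i \<le> h + 9" and h5: "5 \<le> h"
          unfolding h' using m by linarith+
        have "2 * real i * h + 2 * (h + 1 + real i) \<le> (h + 9) * h + 2 * h + 2 + (h + 9)"
          using mult_right_mono[OF i9, of h] i9 h5 by (simp add: algebra_simps)
        also have "\<dots> \<le> h * (h + 1) * (h - 1)"
        proof -
          have "5 * (5 * h) \<le> h * (h * h)" "5 * h \<le> h * h" "5 * (h * h) \<le> h * (h * h)"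
            using h5 mult_mono[of 5 h 5 h] by (auto intro!: mult_mono)
          moreover have "h * (h + 1) * (h - 1) = h * (h * h) - h" "(h + 9) * h = h * h + 9 * h"
            by Groebner_Basis.algebra+
          ultimately show ?thesis using h5 by linarith
        qed
        finally show ?thesis .
      qed
      then show "2 * real i * h + 2 * (real k - real l)\<^sup>2 * (h + 1 + real i)
          \<le> h * (h + 1) * (h - (4 * real m - real (k + l)))"
        unfolding \<delta> \<epsilon> by simp
    next
      show "real m * (real (k + l) - 1) = real (k * l)"
        unfolding of_nat_add of_nat_mult kl by (simp add: algebra_simps)
    qed (use m j True in \<open>auto simp: k_def l_def\<close>)
  next
    case False
    then have m3: "3 \<le> m" using j by (auto simp: J_def split: if_splits)
    show ?thesis
    proof (rule eberlein_large_index[where J = J])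
      fix i assume i: "i \<le> m" "i \<le> J"
      have c: "real (k + l) - 1 = 4 * real m - 2"
        unfolding of_nat_add kl by simp
      consider "m = 3" | "m = 4" | "m = 5" | "6 \<le> m" using m3 by linarith
      then show "real ((l - J) choose (m - i)) * (real (k + l) - 1) \<le> real (l choose m)"
      proof cases
        case 1
        then have "i \<in> {0,1,2,3}" using i by auto
        then show ?thesis unfolding c by (auto simp: 1 J_def l_def eval_nat_numeral)
      next
        case 2
        then have "i \<in> {0,1,2,3,4}" using i by auto
        then show ?thesis unfolding c by (auto simp: 2 J_def l_def eval_nat_numeral)
      next
        case 3
        then have "i \<in> {0,1,2,3,4,5}" using i by auto
        then show ?thesis unfolding c by (auto simp: 3 J_def l_def eval_nat_numeral)
      next
        case 4
        \<comment> \<open>The largest exponent that \<open>binomial_power_bound\<close> admits for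
          \<open>J = m + 3\<close>. Because \<open>l = 2 * m\<close>, both ratio conditions hold
          with \<open>\<rho> = 2\<close>.\<close>
        define t where "t = (m + 4) div 2"
        have J: "J = m + 3" using 4 by (simp add: J_def)
        have "5 \<le> t" "m + 3 \<le> 2 * t" using 4 unfolding t_def by auto
        then have "4 * real m - 2 \<le> 2 ^ t"
          using two_power_ge[of t] by linarith
        then have "real ((l - J) choose (m - i)) * (real (k + l) - 1) \<le> real ((l - J) choose (m - i)) * 2 ^ t"
          unfolding c by (intro mult_left_mono) simp_all
        also have "\<dots> \<le> real (l choose m)"
          using i 4 unfolding J t_def
          by (intro binomial_power_bound) (auto simp: l_def)
        finally show ?thesis .
      qed
    qed (use j False m in \<open>auto simp: k_def l_def\<close>)
  qed
qed

lemma eberlein_bound_square: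
  fixes s j :: nat
  assumes s: "0 < s" and j: "1 \<le> j" "j \<le> 2 * s\<^sup>2 - s"
  defines "k \<equiv> 2 * s\<^sup>2 - s" and "l \<equiv> 2 * s\<^sup>2 + s"
  shows "\<bar>eberlein k l (s\<^sup>2) j\<bar> * (real (k + l) - 1) \<le> eberlein k l (s\<^sup>2) 0"
proof -
  \<comment> \<open>Every \<open>i < J\<close> in range satisfies \<open>i \<le> s\<^sup>2\<close>,
    which is \<open>2 * i \<le> h\<close>. For \<open>s = 1\<close> only \<open>j = 1\<close>
    exists; for \<open>s = 2\<close> and \<open>s = 3\<close> the binomials needed from
    \<open>J\<close> on are evaluated.\<close>
  define J where "J = (if s = 1 then 1 else if s = 2 then 5 else if s = 3 then 6 else s\<^sup>2)"
  have ss: "s \<le> s\<^sup>2" using s by (simp add: power2_eq_square)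
  have kl: "real k = 2 * (real s)\<^sup>2 - real s" "real l = 2 * (real s)\<^sup>2 + real s"
    using ss by (simp_all add: k_def l_def of_nat_diff)
  show ?thesis
  proof (cases "j \<le> J")
    case True
    show ?thesis
    proof (rule eberlein_small_index[where J = J])
      fix i :: nat and h :: real
      assume i: "2 \<le> i" "i < J" "i < k" and h: "h = real (k + l) - 2 * real i"
      have h': "h = 4 * (real s)\<^sup>2 - 2 * real i" and \<delta>: "4 * real (s\<^sup>2) - real (k + l) = 0"
        and \<epsilon>: "(real k - real l)\<^sup>2 = h + 2 * real i"
        unfolding h of_nat_add kl by (simp_all add: power2_eq_square)
      have "2 * s \<le> s\<^sup>2" "4 \<le> s\<^sup>2" if "2 \<le> s"
        using that mult_mono[of 2 s 2 s] by (simp_all add: power2_eq_square)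
      then have "2 * i \<le> 4 * s\<^sup>2 - 2 * i" "4 * s\<^sup>2 \<ge> 2 * i + 7"
        using i unfolding J_def by (auto split: if_splits)
      then have ih: "2 * real i \<le> h" and h7: "7 \<le> h"
        unfolding h' using of_nat_power[of s 2, where 'a = real] by linarith+
      have "2 * real i * h + 2 * (h + 2 * real i) * (h + 1 + real i) \<le> h * h + (4 * h) * (h + 1 + h / 2)"
      proof (rule add_mono)
        show "2 * real i * h \<le> h * h"
          using ih h7 by (intro mult_right_mono) simp_all
        show "2 * (h + 2 * real i) * (h + 1 + real i) \<le> (4 * h) * (h + 1 + h / 2)"
          by (rule mult_mono) (use ih h7 in simp_all)
      qed
      also have "\<dots> \<le> h * (h + 1) * h"
      proof -
        have "7 * (h * h) \<le> h * (h * h)" "7 * h \<le> h * h"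
          using h7 by (auto intro!: mult_mono)
        moreover have e1: "h * h + (4 * h) * (h + 1 + h / 2) = 7 * (h * h) + 4 * h"
          and e2: "h * (h + 1) * h = h * (h * h) + h * h"
          by (simp_all add: algebra_simps)
        ultimately show ?thesis unfolding e1 e2 using h7 by linarith
      qed
      finally show "2 * real i * h + 2 * (real k - real l)\<^sup>2 * (h + 1 + real i)
          \<le> h * (h + 1) * (h - (4 * real (s\<^sup>2) - real (k + l)))"
        unfolding \<delta> \<epsilon> by simp
    next
      show "real (s\<^sup>2) * (real (k + l) - 1) = real (k * l)"
        unfolding of_nat_add of_nat_mult kl by (simp add: algebra_simps power2_eq_square)
    qed (use s ss j True in \<open>auto simp: k_def l_def\<close>)
  next
    case False
    then have s2: "2 \<le> s" using j s by (auto simp: J_def split: if_splits)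
    have c: "real (k + l) - 1 = 4 * (real s)\<^sup>2 - 1"
      unfolding of_nat_add kl by simp
    show ?thesis
    proof (rule eberlein_large_index[where J = J])
      fix i assume i: "i \<le> s\<^sup>2" "i \<le> J"
      consider "s = 2" | "s = 3" | "4 \<le> s" using s2 by linarith
      then show "real ((l - J) choose (s\<^sup>2 - i)) * (real (k + l) - 1) \<le> real (l choose s\<^sup>2)"
      proof cases
        case 1
        then have "i \<in> {0,1,2,3,4}" using i by auto
        then show ?thesis unfolding c by (auto simp: 1 J_def l_def eval_nat_numeral)
      next
        case 2
        then have "i \<in> {0,1,2,3,4,5,6}" using i by (auto simp: J_def)
        then show ?thesis unfolding c by (auto simp: 2 J_def l_def binomial_fact' fact_numeral)
      next
        case 3
        define t where "t = (s\<^sup>2 + 1) div 2"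
        have J: "J = s\<^sup>2" using 3 by (simp add: J_def)
        have s4: "4 * s \<le> s\<^sup>2" "16 \<le> s\<^sup>2" using 3 mult_mono[of 4 s 4 s] by (simp_all add: power2_eq_square)
        then have "8 \<le> t" "s\<^sup>2 \<le> 2 * t" unfolding t_def by auto
        then have "4 * (real s)\<^sup>2 - 1 \<le> (9 / 5) ^ t"
          using nine_fifths_power_ge[of t] of_nat_power[of s 2, where 'a = real] by linarith
        then have "real ((l - J) choose (s\<^sup>2 - i)) * (real (k + l) - 1) \<le> real ((l - J) choose (s\<^sup>2 - i)) * (9 / 5) ^ t"
          unfolding c by (intro mult_left_mono) simp_all
        also have "\<dots> \<le> real (l choose s\<^sup>2)"
        \<comment> \<open>With \<open>\<rho> = 9 / 5\<close> the second ratio condition reads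
          \<open>4 * s \<le> s\<^sup>2\<close>, whence the case split at \<open>s = 4\<close>. The
          value \<open>\<rho> = 2\<close> would fail, as \<open>l - s\<^sup>2\<close> exceeds
          \<open>l / 2\<close>.\<close>
        proof (rule binomial_power_bound)
          have "4 * real s \<le> real (s\<^sup>2)" using s4(1) by (metis of_nat_le_iff of_nat_mult of_nat_numeral)
          then show "real (s\<^sup>2) * (9 / 5) \<le> real l" "(real l - real (s\<^sup>2)) * (9 / 5) \<le> real l"
            unfolding kl by (simp_all add: field_simps)
        qed (use i in \<open>auto simp: J l_def t_def\<close>)
        finally show ?thesis .
      qed
    next
      have "real 1 \<le> real (k + l)"
        unfolding of_nat_le_iff using s by (simp add: l_def)
      then show "0 \<le> real (k + l) - 1" by simp
    qed (use j False in \<open>auto simp: k_def l_def\<close>)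
  qed
qed

text \<open>With \<open>u = l - k\<close> and \<open>d = 4 * r - (k + l)\<close> the equation
  becomes \<open>d * (k + l - 1) = k + l - u\<^sup>2\<close>. Hence \<open>d = 0\<close> and
  \<open>u\<^sup>2 = 4 * r\<close>, or \<open>d = 1\<close> and \<open>u = 1\<close>, or
  \<open>k + l \<le> 2\<close>. Symmetry allows \<open>k \<le> l\<close>.\<close>

lemma eberlein_bound:
  fixes k l r j :: nat
  assumes r: "0 < r" "r \<le> k" "r \<le> l" and n: "k + l \<le> 4 * r"
    and kl: "r * (k + l - 1) = k * l"
    and j: "1 \<le> j" "j \<le> k" "j \<le> l"
  shows "\<bar>eberlein k l r j\<bar> * (real (k + l) - 1) \<le> eberlein k l r 0"
proof -
  have main: "\<bar>eberlein k l r j\<bar> * (real (k + l) - 1) \<le> eberlein k l r 0"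
    if "k \<le> l" and r: "0 < r" "r \<le> k" "r \<le> l" and n: "k + l \<le> 4 * r"
      and kl: "r * (k + l - 1) = k * l" and j: "1 \<le> j" "j \<le> k" for k l :: nat
  proof -
    define u d where "u = l - k" and "d = 4 * r - (k + l)"
    have l: "l = k + u" and r4: "4 * r = k + l + d"
      using that by (simp_all add: u_def d_def)
    have klr: "real r * (real k + real l - 1) = real k * real l"
    proof -
      have "real (k + l - 1) = real k + real l - 1" using r by (simp add: of_nat_diff)
      then show ?thesis using arg_cong[OF kl, of real] by simp
    qed
    have "real d * (real k + real l - 1) = real k + real l - (real u)\<^sup>2"
    proof -
      have "real d = 4 * real r - (real k + real l)"
        using arg_cong[OF r4, of real] by simp
      then have "real d * (real k + real l - 1) = 4 * (real k * real l) - (real k + real l) * (real k + real l - 1)"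
        unfolding klr[symmetric] by Groebner_Basis.algebra
      also have "\<dots> = real k + real l - (real u)\<^sup>2"
        by (simp add: l power2_eq_square algebra_simps)
      finally show ?thesis .
    qed
    then have "real (d * (k + l) + u\<^sup>2) = real (k + l + d)"
      by (simp add: algebra_simps)
    then have du: "d * (k + l) + u\<^sup>2 = k + l + d"
      using of_nat_eq_iff by blast
    consider "d = 0" | "d = 1" | "2 \<le> d" by linarith
    then show ?thesis
    proof cases
      case 1
      then have "u\<^sup>2 = 4 * r" using du r4 by simp
      then have "even u" by (metis even_mult_iff even_numeral even_power)
      then obtain s where s: "u = 2 * s" by blast
      have "r = s\<^sup>2" using \<open>u\<^sup>2 = 4 * r\<close> by (simp add: s power_mult_distrib)
      moreover from this have "2 * k + 2 * s = 4 * s\<^sup>2" using r4 1 s l by simp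
      then have "k = 2 * s\<^sup>2 - s" "l = 2 * s\<^sup>2 + s" using s l by auto
      ultimately show ?thesis
        using eberlein_bound_square[of s j] r j by (cases "s = 0") auto
    next
      case 2
      then have "u\<^sup>2 = 1" using du by simp
      then have "u = 1" by simp
      then have "k = 2 * r - 1" "l = 2 * r" using r4 2 l by auto
      then show ?thesis using eberlein_bound_hadamard[of j r] r j by simp
    next
      case 3
      have "k + l \<le> 2"
      proof (rule ccontr)
        assume "\<not> k + l \<le> 2"
        moreover have "d * (k + l - 1) + u\<^sup>2 = k + l"
          using du r by (cases "k + l") auto
        moreover have "2 * (k + l - 1) \<le> d * (k + l - 1)" using 3 by simp
        ultimately show False by linarith
      qed
      then have "k = 1" "l = 1" "j = 1" "r = 1" using r j by auto
      then show ?thesis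
        by (simp add: eberlein_def atMost_Suc)
    qed
  qed
  show ?thesis
  proof (cases "k \<le> l")
    case True
    then show ?thesis using main assms by blast
  next
    case False
    have "\<bar>eberlein l k r j\<bar> * (real (l + k) - 1) \<le> eberlein l k r 0"
      by (rule main) (use False assms in \<open>auto simp: add.commute mult.commute\<close>)
    then show ?thesis by (simp add: eberlein_commute[of k l] add.commute)
  qed
qed

section \<open>Spectrum of the generalized Johnson graphs\<close>

text \<open>Minimize the quadratic form over the unit sphere. Moving a minimizer \<open>f\<close>
  along its residual \<open>e\<close>, which is \<open>M f - \<mu> f\<close>, would push the form
  below its minimum unless \<open>e\<close> vanishes.\<close>

lemma symmetric_min_eigenvector:
  fixes M :: "'a \<Rightarrow> 'a \<Rightarrow> real"
  assumes V: "finite V" "V \<noteq> {}" and sym: "\<And>u v. u \<in> V \<Longrightarrow> v \<in> V \<Longrightarrow> M u v = M v u"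
  shows "\<exists>\<mu> f. (\<exists>v\<in>V. f v \<noteq> 0) \<and> (\<forall>u\<in>V. (\<Sum>v\<in>V. M u v * f v) = \<mu> * f u) \<and>
    (\<forall>g. \<mu> * (\<Sum>u\<in>V. (g u)\<^sup>2) \<le> (\<Sum>u\<in>V. \<Sum>v\<in>V. M u v * g u * g v))"
proof -
  define B where "B g h = (\<Sum>u\<in>V. \<Sum>v\<in>V. M u v * g u * h v)" for g h :: "'a \<Rightarrow> real"
  define N where "N g = (\<Sum>u\<in>V. (g u)\<^sup>2)" for g :: "'a \<Rightarrow> real"
  \<comment> \<open>The sphere is taken inside a product of intervals, compact by Tychonoff. Off
    \<open>V\<close> the functions are set to 0, since \<open>N\<close> does not control them
    there.\<close>
  define K where "K = PiE UNIV (\<lambda>v. if v \<in> V then {-1..1::real} else {0})"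
  have "compactin (product_topology (\<lambda>_. euclidean) UNIV) K"
    unfolding K_def by (simp add: compactin_PiE)
  then have "compact K"
    by (simp add: euclidean_product_topology)
  have coord: "continuous_on A (\<lambda>g. g v)" for A and v :: 'a and g :: "'a \<Rightarrow> real"
    by (rule continuous_on_subset[OF continuous_on_product_coordinates]) simp
  have cont: "continuous_on UNIV N" "continuous_on A (\<lambda>g. B g g)" for A
    unfolding N_def B_def by (intro continuous_intros coord)+
  have "closed {g. N g = 1}"
    using closed_vimage[OF _ cont(1), of "{1}"] by (simp add: vimage_def)
  with \<open>compact K\<close> have S: "compact (K \<inter> {g. N g = 1})"
    by (rule compact_Int_closed)
  obtain v0 where "v0 \<in> V" using V by blast
  then have "(\<lambda>v. if v = v0 then 1 else 0) \<in> K" "N (\<lambda>v. if v = v0 then 1 else 0) = 1"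
    using V by (auto simp: K_def PiE_iff) (simp add: N_def if_distrib[of "\<lambda>x. x\<^sup>2"] cong: if_cong)
  then obtain f where f: "f \<in> K" "N f = 1" and min: "\<And>g. g \<in> K \<Longrightarrow> N g = 1 \<Longrightarrow> B f f \<le> B g g"
    using continuous_attains_inf[OF S _ cont(2)] by blast
  define \<mu> where "\<mu> = B f f"
  have N0: "N g \<ge> 0" for g
    unfolding N_def by (intro sum_nonneg) simp
  have scale: "B (\<lambda>v. c * g v) (\<lambda>v. d * h v) = c * d * B g h" for c d g h
    unfolding B_def by (simp add: sum_distrib_left mult_ac)
  have lower: "\<mu> * N g \<le> B g g" for g
  proof (cases "N g = 0")
    case True
    then have "\<forall>v\<in>V. g v = 0" using V by (simp add: N_def sum_nonneg_eq_0_iff)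
    then show ?thesis using True by (simp add: B_def)
  next
    case False
    define c where "c = 1 / sqrt (N g)"
    have c: "c * c = 1 / N g" using N0[of g] unfolding c_def by simp
    define h where "h v = (if v \<in> V then c * g v else 0)" for v
    have "N h = c * c * N g"
      unfolding N_def h_def by (simp add: sum_distrib_left power2_eq_square mult_ac)
    then have "N h = 1" using False c by simp
    moreover have "h \<in> K"
    proof -
      have "(h v)\<^sup>2 \<le> 1" if "v \<in> V" for v
        using \<open>N h = 1\<close> V that member_le_sum[of v V "\<lambda>v. (h v)\<^sup>2"] by (simp add: N_def)
      then show ?thesis
        by (auto simp: K_def h_def abs_square_le_1 abs_le_iff)
    qed
    ultimately have "\<mu> \<le> B h h" unfolding \<mu>_def by (rule min[rotated])
    also have "B h h = B (\<lambda>v. c * g v) (\<lambda>v. c * g v)"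
      unfolding B_def h_def by (intro sum.cong) simp_all
    also have "\<dots> = B g g / N g" using scale c by simp
    finally show ?thesis using False N0[of g] by (simp add: field_simps)
  qed
  define e where "e u = (\<Sum>v\<in>V. M u v * f v) - \<mu> * f u" for u
  have addl: "B (\<lambda>v. g v + g' v) h = B g h + B g' h" and addr: "B h (\<lambda>v. g v + g' v) = B h g + B h g'" for g g' h
    unfolding B_def by (simp_all add: algebra_simps sum.distrib)
  have Bsym: "B g h = B h g" for g h
    unfolding B_def by (subst sum.swap) (intro sum.cong refl, simp add: sym mult_ac)
  have Bef: "B e f = N e + \<mu> * (\<Sum>u\<in>V. e u * f u)"
  proof -
    have "B e f = (\<Sum>u\<in>V. e u * (\<Sum>v\<in>V. M u v * f v))"
      unfolding B_def by (simp add: sum_distrib_left mult_ac)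
    also have "\<dots> = (\<Sum>u\<in>V. e u * (e u + \<mu> * f u))"
      by (simp add: e_def)
    finally show ?thesis
      by (simp add: N_def algebra_simps sum.distrib sum_distrib_left power2_eq_square)
  qed
  define p q where "p = N e" and "q = B e e - \<mu> * N e"
  \<comment> \<open>This choice makes \<open>t * t * q - 2 * t * p\<close> equal to
    \<open>- p\<^sup>2 * (q + 2) / (q + 1)\<^sup>2\<close>; the added 1 keeps the denominator
    positive when \<open>q = 0\<close>.\<close>
  define t where "t = p / (q + 1)"
  have q: "q \<ge> 0" and p: "p \<ge> 0" using lower N0 by (simp_all add: q_def p_def)
  have "0 \<le> B (\<lambda>v. f v + (- t) * e v) (\<lambda>v. f v + (- t) * e v) - \<mu> * N (\<lambda>v. f v + (- t) * e v)"
    using lower by simp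
  also have "N (\<lambda>v. f v + (- t) * e v) = 1 - 2 * t * (\<Sum>u\<in>V. e u * f u) + t * t * N e"
    using f(2) unfolding N_def
    by (simp add: power2_eq_square algebra_simps sum.distrib sum_distrib_left sum_subtractf)
  also have "B (\<lambda>v. f v + (- t) * e v) (\<lambda>v. f v + (- t) * e v) = \<mu> - 2 * t * B e f + t * t * B e e"
    unfolding addl addr
    using scale[of 1 f "- t" e] scale[of "- t" e 1 f] scale[of "- t" e "- t" e] Bsym[of f e]
    by (simp add: \<mu>_def)
  finally have "0 \<le> t * t * q - 2 * t * p"
    unfolding Bef p_def q_def by (simp add: algebra_simps)
  then have "0 \<le> (t * t * q - 2 * t * p) * ((q + 1) * (q + 1))"
    using q by (intro mult_nonneg_nonneg) simp_all
  also have "\<dots> = - (p * p * (q + 2))"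
  proof -
    have "t * (q + 1) = p" using q unfolding t_def by simp
    moreover have "(t * t * q - 2 * t * p) * ((q + 1) * (q + 1))
        = (t * (q + 1)) * (t * (q + 1)) * q - 2 * (t * (q + 1)) * p * (q + 1)"
      by (simp add: algebra_simps)
    ultimately show ?thesis by (simp add: algebra_simps)
  qed
  finally have "p * p * (q + 2) \<le> 0" by simp
  then have "p = 0" using q by (auto simp: mult_le_0_iff)
  then have "\<forall>u\<in>V. e u = 0"
    using V unfolding p_def N_def by (simp add: sum_nonneg_eq_0_iff)
  moreover have "\<exists>v\<in>V. f v \<noteq> 0"
    using f(2) unfolding N_def by (rule contrapos_pp) simp
  ultimately show ?thesis
    using lower unfolding e_def N_def B_def by (intro exI[of _ \<mu>] exI[of _ f]) simp
qed

section \<open>Functions antisymmetric under disjoint transpositions\<close>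

text \<open>The pairs are encoded by a fixed-point-free involution \<open>\<sigma>\<close> on their
  union \<open>P\<close>, so that neither point of a pair is singled out.\<close>

definition skew_matching ::
    "'a set \<Rightarrow> 'a set set \<Rightarrow> 'a set \<Rightarrow> ('a \<Rightarrow> 'a) \<Rightarrow> ('a set \<Rightarrow> real) \<Rightarrow> bool" where
  "skew_matching S V P \<sigma> f \<longleftrightarrow> P \<subseteq> S \<and>
     (\<forall>x\<in>P. \<sigma> x \<in> P \<and> \<sigma> x \<noteq> x \<and> \<sigma> (\<sigma> x) = x \<and> (\<forall>u\<in>V. f (Transposition.transpose x (\<sigma> x) ` u) = - f u))"

lemma transpose_image_image [simp]:
  "Transposition.transpose a b ` Transposition.transpose a b ` u = u"
  by (simp add: image_image)

lemma transpose_image_image_commute: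
  assumes "{a, b} \<inter> {c, d} = {}"
  shows "Transposition.transpose a b ` Transposition.transpose c d ` u
    = Transposition.transpose c d ` Transposition.transpose a b ` u"
  unfolding image_image using assms
  by (intro image_cong refl) (auto simp: Transposition.transpose_def)

lemma transpose_image_fixed:
  assumes "x \<in> u \<longleftrightarrow> y \<in> u"
  shows "Transposition.transpose x y ` u = u"
  using assms by (intro Set.set_eqI) (auto simp: in_transpose_image_iff Transposition.transpose_def)

lemma transpose_image_swap:
  assumes "x \<in> v" "y \<notin> v"
  shows "Transposition.transpose x y ` v = insert y (v - {x})"
  using assms by (intro Set.set_eqI) (auto simp: in_transpose_image_iff Transposition.transpose_def)

locale slice =
  fixes S :: "'a set" and k :: nat
  assumes finite_S: "finite S"
begin

definition V :: "'a set set" where "V = {u. u \<subseteq> S \<and> card u = k}"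

lemma finite_V: "finite V"
  unfolding V_def using finite_S by simp

lemma VD: "u \<in> V \<Longrightarrow> u \<subseteq> S" "u \<in> V \<Longrightarrow> card u = k" "u \<in> V \<Longrightarrow> finite u"
  unfolding V_def using finite_S finite_subset by auto

lemma transpose_image_in_V:
  assumes "u \<in> V" "a \<in> S" "b \<in> S"
  shows "Transposition.transpose a b ` u \<in> V"
proof -
  have "Transposition.transpose a b ` u \<subseteq> S"
    using VD(1)[OF assms(1)] assms(2,3) by (auto simp: Transposition.transpose_def)
  moreover have "card (Transposition.transpose a b ` u) = k"
    using VD(2)[OF assms(1)] by (simp add: card_image)
  ultimately show ?thesis by (simp add: V_def)
qed

text \<open>Antisymmetrizing over as many disjoint transpositions as possible without killing the
  function leaves one that is invariant under all transpositions off the matching.\<close>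

lemma maximal_skew_matching:
  assumes W: "\<And>f a b. W f \<Longrightarrow> a \<in> S \<Longrightarrow> b \<in> S \<Longrightarrow> W (\<lambda>u. f u - f (Transposition.transpose a b ` u))"
    and f0: "W f0" "\<exists>u\<in>V. f0 u \<noteq> 0"
  obtains f P \<sigma> where "W f" "\<exists>u\<in>V. f u \<noteq> 0" "skew_matching S V P \<sigma> f"
    "\<And>c d u. c \<in> S - P \<Longrightarrow> d \<in> S - P \<Longrightarrow> u \<in> V \<Longrightarrow> f (Transposition.transpose c d ` u) = f u"
proof -
  define good where "good m \<longleftrightarrow> (\<exists>f P \<sigma>. W f \<and> (\<exists>u\<in>V. f u \<noteq> 0) \<and> skew_matching S V P \<sigma> f \<and> card P = m)" for m
  have "good 0"
    unfolding good_def using f0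
    by (intro exI[of _ f0] exI[of _ "{}"]) (auto simp: skew_matching_def)
  moreover have "m \<le> card S" if "good m" for m
    using that finite_S unfolding good_def skew_matching_def by (auto intro: card_mono)
  ultimately have "\<exists>m. good m \<and> (\<forall>m'. good m' \<longrightarrow> m' \<le> m)"
    by (metis Nat.ex_has_greatest_nat)
  then obtain m where "good m" and max: "\<And>m'. good m' \<Longrightarrow> m' \<le> m" by blast
  then obtain f P \<sigma> where f: "W f" "\<exists>u\<in>V. f u \<noteq> 0" "skew_matching S V P \<sigma> f" "card P = m"
    unfolding good_def by blast
  have P: "P \<subseteq> S" "finite P"
    using f(3) finite_S unfolding skew_matching_def by (auto intro: finite_subset)
  have "f (Transposition.transpose c d ` u) = f u" if cd: "c \<in> S - P" "d \<in> S - P" and u: "u \<in> V" for c d u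
  proof (rule ccontr)
    assume neq: "f (Transposition.transpose c d ` u) \<noteq> f u"
    then have "c \<noteq> d" by auto
    \<comment> \<open>Antisymmetrizing over \<open>c\<close> and \<open>d\<close> adds a pair:
      disjoint transpositions commute, so the old antisymmetries survive, and \<open>g\<close>
      contradicts maximality.\<close>
    define g where "g u = f u - f (Transposition.transpose c d ` u)" for u
    define P' \<sigma>' where "P' = P \<union> {c, d}" and "\<sigma>' = \<sigma>(c := d, d := c)"
    have "skew_matching S V P' \<sigma>' g"
      unfolding skew_matching_def
    proof (intro conjI ballI)
      show "P' \<subseteq> S" using P cd by (auto simp: P'_def)
      fix x assume x: "x \<in> P'"
      show "\<sigma>' x \<in> P'" "\<sigma>' x \<noteq> x" "\<sigma>' (\<sigma>' x) = x"
        using x f(3) cd \<open>c \<noteq> d\<close> unfolding P'_def \<sigma>'_def skew_matching_def by auto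
      fix w assume w: "w \<in> V"
      show "g (Transposition.transpose x (\<sigma>' x) ` w) = - g w"
      proof (cases "x \<in> P")
        case True
        then have x: "\<sigma>' x = \<sigma> x" "\<sigma> x \<in> P" "x \<in> S" "\<sigma> x \<in> S" and disj: "{c, d} \<inter> {x, \<sigma> x} = {}"
          using cd f(3) P unfolding \<sigma>'_def skew_matching_def by auto
        have neg: "f (Transposition.transpose x (\<sigma> x) ` v) = - f v" if "v \<in> V" for v
          using that True f(3) unfolding skew_matching_def by blast
        show ?thesis
          unfolding g_def x(1) transpose_image_image_commute[OF disj]
          using neg w transpose_image_in_V cd by simp
      next
        case False
        with x have "x = c \<or> x = d" by (auto simp: P'_def)
        then show ?thesis
          unfolding g_def \<sigma>'_def using \<open>c \<noteq> d\<close>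
          by (auto simp: transpose_commute[of d c])
      qed
    qed
    moreover have "W g" unfolding g_def using W f(1) cd by blast
    moreover have "\<exists>u\<in>V. g u \<noteq> 0" using u neq unfolding g_def by (intro bexI[of _ u]) simp_all
    moreover have "card P' = m + 2" using P cd f(4) \<open>c \<noteq> d\<close> by (simp add: P'_def)
    ultimately have "good (m + 2)" unfolding good_def by blast
    then show False using max by force
  qed
  with f show thesis using that by blast
qed

text \<open>If \<open>u\<close> contained both or neither point of a pair, the swap would fix
  \<open>u\<close> yet negate the value, forcing it to be 0.\<close>

lemma skew_matching_transversal:
  assumes "skew_matching S V P \<sigma> f" "u \<in> V" "f u \<noteq> 0" "x \<in> P"
  shows "\<sigma> x \<in> u \<longleftrightarrow> x \<notin> u"
proof (rule ccontr)
  assume "\<not> ?thesis"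
  then have "Transposition.transpose x (\<sigma> x) ` u = u"
    by (intro transpose_image_fixed) blast
  moreover have "f (Transposition.transpose x (\<sigma> x) ` u) = - f u"
    using assms unfolding skew_matching_def by blast
  ultimately show False using assms(3) by simp
qed

text \<open>Induction on \<open>card (v - u)\<close> moves \<open>v\<close> to \<open>u\<close> one
  exchange at a time: swapping a matched pair costs a sign, exchanging two unmatched points costs
  nothing.\<close>

lemma skew_matching_value:
  assumes skew: "skew_matching S V P \<sigma> f"
    and inv: "\<And>c d u. c \<in> S - P \<Longrightarrow> d \<in> S - P \<Longrightarrow> u \<in> V \<Longrightarrow> f (Transposition.transpose c d ` u) = f u"
    and u: "u \<in> V" "\<And>x. x \<in> P \<Longrightarrow> \<sigma> x \<in> u \<longleftrightarrow> x \<notin> u"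
    and v: "v \<in> V" "\<And>x. x \<in> P \<Longrightarrow> \<sigma> x \<in> v \<longleftrightarrow> x \<notin> v"
  shows "f v = (- 1) ^ card ((v - u) \<inter> P) * f u"
  using v
proof (induction "card (v - u)" arbitrary: v)
  case 0
  then have "v \<subseteq> u" using VD(3) by simp
  then have "v = u" using 0 u VD by (metis card_subset_eq)
  then show ?case by simp
next
  case (Suc c)
  have fin: "finite v" "finite u" using Suc.prems u VD by auto
  have \<sigma>: "\<sigma> z \<in> P" "\<sigma> (\<sigma> z) = z" if "z \<in> P" for z
    using that skew unfolding skew_matching_def by auto
  have "v - u \<noteq> {}" using Suc.hyps(2) by (metis Zero_not_Suc card.empty)
  then obtain x where x: "x \<in> v" "x \<notin> u" by blast
  show ?case
  proof (cases "x \<in> P")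
    case True
    define w where "w = Transposition.transpose x (\<sigma> x) ` v"
    have y: "\<sigma> x \<notin> v" "\<sigma> x \<in> u" "\<sigma> x \<in> P" using Suc.prems(2) u(2) True x \<sigma> by auto
    have w: "w = insert (\<sigma> x) (v - {x})" unfolding w_def using x(1) y(1) by (rule transpose_image_swap)
    have "w \<in> V" unfolding w_def
      using Suc.prems(1) True y skew unfolding skew_matching_def by (intro transpose_image_in_V) auto
    have wu: "w - u = (v - u) - {x}" using w y by auto
    have trans: "\<sigma> z \<in> w \<longleftrightarrow> z \<notin> w" if "z \<in> P" for z
      unfolding w using Suc.prems(2)[OF that] \<sigma>[OF that] \<sigma>(2)[OF True] x y
      by (cases "z = x"; cases "z = \<sigma> x") auto
    have "c = card (w - u)"
      unfolding wu using Suc.hyps(2) x fin by simp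
    then have IH: "f w = (- 1) ^ card ((w - u) \<inter> P) * f u"
      using \<open>w \<in> V\<close> trans by (rule Suc.hyps(1))
    have "(v - u) \<inter> P = insert x ((w - u) \<inter> P)" "x \<notin> (w - u) \<inter> P"
      unfolding wu using x True by auto
    then have "card ((v - u) \<inter> P) = Suc (card ((w - u) \<inter> P))"
      using fin by (simp add: w)
    moreover have "f w = - f v"
      using skew True Suc.prems(1) unfolding skew_matching_def w_def by blast
    ultimately show ?thesis using IH by simp
  next
    case False
    \<comment> \<open>A transversal contains exactly half of \<open>P\<close>, so \<open>u\<close>
      and \<open>v\<close> have equally many points off \<open>P\<close>; this supplies an unmatched
      \<open>y\<close> of \<open>u\<close> to exchange for \<open>x\<close>.\<close>
    have half: "card (z \<inter> P) = card (P - z)" if "\<And>x. x \<in> P \<Longrightarrow> \<sigma> x \<in> z \<longleftrightarrow> x \<notin> z" for z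
    proof (rule bij_betw_same_card[of \<sigma>])
      show "bij_betw \<sigma> (z \<inter> P) (P - z)"
        using that \<sigma> by (intro bij_betw_byWitness[where f' = \<sigma>]) auto
    qed
    have fP: "finite P" using skew finite_S unfolding skew_matching_def by (auto intro: finite_subset)
    have "card (v \<inter> P) = card (u \<inter> P)"
    proof -
      have "card P = card (z \<inter> P) + card (P - z)" for z
        using card_Int_Diff[OF fP, of z] by (simp add: Int_commute)
      then show ?thesis using half[OF Suc.prems(2)] half[OF u(2)] by (metis add_self_div_2)
    qed
    then have "card (v - P) = card (u - P)"
      using fin VD(2)[OF u(1)] VD(2)[OF Suc.prems(1)] card_Int_Diff[of v P] card_Int_Diff[of u P] by simp
    moreover have "v - P \<noteq> u - P" using x False by blast
    ultimately have "\<not> u - P \<subseteq> v - P"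
      using fin by (metis card_subset_eq finite_Diff)
    then obtain y where y: "y \<in> u" "y \<notin> v" "y \<notin> P" by blast
    define w where "w = Transposition.transpose x y ` v"
    have w: "w = insert y (v - {x})" unfolding w_def using x(1) y(2) by (rule transpose_image_swap)
    have xyS: "x \<in> S - P" "y \<in> S - P" using x y False u(1) Suc.prems(1) VD(1) by auto
    then have "w \<in> V" unfolding w_def
      using Suc.prems(1) by (intro transpose_image_in_V) auto
    have wu: "w - u = (v - u) - {x}" using w y by auto
    have trans: "\<sigma> z \<in> w \<longleftrightarrow> z \<notin> w" if "z \<in> P" for z
      unfolding w using Suc.prems(2)[OF that] \<sigma>[OF that] False y that by auto
    have "c = card (w - u)"
      unfolding wu using Suc.hyps(2) x fin by simp
    then have IH: "f w = (- 1) ^ card ((w - u) \<inter> P) * f u"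
      using \<open>w \<in> V\<close> trans by (rule Suc.hyps(1))
    have "(v - u) \<inter> P = (w - u) \<inter> P"
      unfolding wu using False by auto
    moreover have "f w = f v"
      using inv[OF xyS Suc.prems(1)] by (simp add: w_def)
    ultimately show ?thesis using IH by simp
  qed
qed

text \<open>Only sets \<open>v\<close> meeting each pair once contribute. Such a \<open>v\<close>
  arises from \<open>u\<close> by swapping the pairs of \<open>X\<close>, dropping \<open>Y'\<close>
  and adding \<open>Z'\<close>, with sign determined by \<open>card X\<close>; counting the triples
  by \<open>card X\<close> gives the Eberlein sum.\<close>

lemma johnson_eigenvalue:
  fixes f :: "'a set \<Rightarrow> real"
  assumes r: "r \<le> k"
    and skew: "skew_matching S V P \<sigma> f" and u: "u \<in> V" "f u \<noteq> 0"
    and inv: "\<And>c d u. c \<in> S - P \<Longrightarrow> d \<in> S - P \<Longrightarrow> u \<in> V \<Longrightarrow> f (Transposition.transpose c d ` u) = f u"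
  shows "card P div 2 \<le> min k (card S - k)"
    and "(\<Sum>v | v \<in> V \<and> card (u \<inter> v) = k - r. f v) = eberlein k (card S - k) r (card P div 2) * f u"
proof -
  note tu = skew_matching_transversal[OF skew u]
  have \<sigma>: "\<sigma> z \<in> P" "\<sigma> (\<sigma> z) = z" if "z \<in> P" for z
    using that skew unfolding skew_matching_def by auto
  have PS: "P \<subseteq> S" using skew unfolding skew_matching_def by blast
  have fin: "finite u" "finite P" using u VD PS finite_S finite_subset by auto
  define A Y Z where "A = u \<inter> P" and "Y = u - P" and "Z = S - P - u"
  define j where "j = card A"
  have finAYZ: "finite A" "finite Y" "finite Z" using fin finite_S unfolding A_def Y_def Z_def by auto
  have inj: "inj_on \<sigma> P" using \<sigma> by (metis inj_onI)
  have \<sigma>A: "\<sigma> ` A = P - u"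
  proof
    show "\<sigma> ` A \<subseteq> P - u" using tu \<sigma> unfolding A_def by auto
    show "P - u \<subseteq> \<sigma> ` A"
    proof
      fix x assume "x \<in> P - u"
      then have "\<sigma> x \<in> A" "x = \<sigma> (\<sigma> x)" using tu \<sigma> unfolding A_def by auto
      then show "x \<in> \<sigma> ` A" by blast
    qed
  qed
  have "card (P - u) = j"
    unfolding \<sigma>A[symmetric] j_def by (rule card_image) (use inj in \<open>auto simp: A_def inj_on_def\<close>)
  have cY: "card Y + j = k"
    using card_Int_Diff[OF fin(1), of P] VD(2)[OF u(1)] unfolding j_def A_def Y_def by simp
  have "card (S - u) = card S - k"
    using VD[OF u(1)] by (simp add: card_Diff_subset)
  moreover have "S - u = (P - u) \<union> Z" "(P - u) \<inter> Z = {}" using PS unfolding Z_def by auto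
  ultimately have cZ: "card Z + j = card S - k"
    using finAYZ fin \<open>card (P - u) = j\<close> by (simp add: card_Un_disjoint)
  define I where "I = {(X, Y', Z'). X \<subseteq> A \<and> Y' \<subseteq> Y \<and> Z' \<subseteq> Z \<and> card X + card Y' = r \<and> card Z' = card Y'}"
  define T where "T = {v. v \<in> V \<and> card (u \<inter> v) = k - r \<and> (\<forall>x\<in>P. \<sigma> x \<in> v \<longleftrightarrow> x \<notin> v)}"
  define dec where "dec v = (A - v, Y - v, Z \<inter> v)" for v
  define enc where "enc = (\<lambda>(X, Y', Z'). (A - X) \<union> \<sigma> ` X \<union> (Y - Y') \<union> Z')"
  have "(\<Sum>v | v \<in> V \<and> card (u \<inter> v) = k - r. f v) = (\<Sum>v\<in>T. f v)"
    unfolding T_def using finite_V skew_matching_transversal[OF skew]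
    by (intro sum.mono_neutral_right) (auto intro: finite_subset[of _ V])
  also have "\<dots> = (\<Sum>v\<in>T. (- 1) ^ card ((v - u) \<inter> P) * f u)"
  proof (rule sum.cong[OF refl])
    fix v assume "v \<in> T"
    then show "f v = (- 1) ^ card ((v - u) \<inter> P) * f u"
      unfolding T_def by (intro skew_matching_value[OF skew inv u(1) tu]) auto
  qed
  also have "\<dots> = (\<Sum>t\<in>I. (- 1) ^ card (fst t) * f u)"
  proof (rule sum.reindex_bij_witness[where i = enc and j = dec])
    fix v assume v: "v \<in> T"
    then have tv: "\<And>x. x \<in> P \<Longrightarrow> \<sigma> x \<in> v \<longleftrightarrow> x \<notin> v" and vV: "v \<in> V" and cuv: "card (u \<inter> v) = k - r"
      unfolding T_def by auto
    have \<sigma>X: "\<sigma> ` (A - v) = (v - u) \<inter> P"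
    proof
      show "\<sigma> ` (A - v) \<subseteq> (v - u) \<inter> P" using tv tu \<sigma> unfolding A_def by auto
      show "(v - u) \<inter> P \<subseteq> \<sigma> ` (A - v)"
      proof
        fix x assume "x \<in> (v - u) \<inter> P"
        then have "\<sigma> x \<in> A - v" "x = \<sigma> (\<sigma> x)" using tv tu \<sigma> unfolding A_def by auto
        then show "x \<in> \<sigma> ` (A - v)" by blast
      qed
    qed
    have cX: "card (A - v) = card ((v - u) \<inter> P)"
      unfolding \<sigma>X[symmetric] by (rule card_image[symmetric]) (use inj in \<open>auto simp: A_def inj_on_def\<close>)
    show "enc (dec v) = v"
      unfolding enc_def dec_def using \<sigma>X VD(1)[OF vV] by (auto simp: A_def Y_def Z_def)
    show "(- 1) ^ card (fst (dec v)) * f u = (- 1) ^ card ((v - u) \<inter> P) * f u"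
      unfolding dec_def using cX by simp
    have "card (u - v) = r"
      using card_Int_Diff[OF fin(1), of v] cuv VD(2)[OF u(1)] r by simp
    moreover have "u - v = (A - v) \<union> (Y - v)" "(A - v) \<inter> (Y - v) = {}"
      unfolding A_def Y_def by auto
    ultimately have c1: "card (A - v) + card (Y - v) = r"
      using finAYZ by (simp add: card_Un_disjoint)
    have "card (v - u) = r"
      using card_Int_Diff[OF VD(3)[OF vV], of u] cuv VD(2)[OF vV] r by (simp add: Int_commute)
    moreover have "v - u = ((v - u) \<inter> P) \<union> (Z \<inter> v)" "((v - u) \<inter> P) \<inter> (Z \<inter> v) = {}"
      using VD(1)[OF vV] unfolding Z_def by auto
    ultimately have "card ((v - u) \<inter> P) + card (Z \<inter> v) = r"
      using finAYZ fin by (metis card_Un_disjoint finite_Int)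
    then show "dec v \<in> I"
      unfolding I_def dec_def using c1 cX by auto
  next
    fix t assume t: "t \<in> I"
    then obtain X Y' Z' where t_eq: "t = (X, Y', Z')" and sub: "X \<subseteq> A" "Y' \<subseteq> Y" "Z' \<subseteq> Z"
      and c: "card X + card Y' = r" "card Z' = card Y'"
      unfolding I_def by auto
    have \<sigma>X: "\<sigma> ` X \<subseteq> P - u" using sub(1) \<sigma>A by auto
    have finX: "finite X" "finite Y'" "finite Z'" using sub finAYZ by (meson finite_subset)+
    have e: "enc t = (A - X) \<union> \<sigma> ` X \<union> (Y - Y') \<union> Z'"
      unfolding enc_def t_eq by simp
    have mem: "x \<in> \<sigma> ` X \<longleftrightarrow> \<sigma> x \<in> X" if "x \<in> P" for x
      using that \<sigma> sub(1) unfolding A_def by (auto intro!: image_eqI[of _ _ "\<sigma> x"])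
    have encP: "x \<in> enc t \<longleftrightarrow> x \<in> A - X \<or> \<sigma> x \<in> X" if "x \<in> P" for x
      using that mem[OF that] sub unfolding e Y_def Z_def by auto
    show "dec (enc t) = t"
      unfolding t_eq dec_def e[unfolded t_eq] using sub \<sigma>X unfolding A_def Y_def Z_def by auto
    have "u \<inter> enc t = (A - X) \<union> (Y - Y')"
      unfolding e using sub \<sigma>X unfolding A_def Y_def Z_def by auto
    moreover have "(A - X) \<inter> (Y - Y') = {}" unfolding A_def Y_def by auto
    ultimately have "card (u \<inter> enc t) = card (A - X) + card (Y - Y')"
      using finAYZ by (simp add: card_Un_disjoint)
    also have "\<dots> = (card A - card X) + (card Y - card Y')"
      using sub finX by (simp add: card_Diff_subset)
    finally have cu: "card (u \<inter> enc t) = k - r"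
      using cY c card_mono[OF finAYZ(1) sub(1)] card_mono[OF finAYZ(2) sub(2)] unfolding j_def by linarith
    have "enc t = (u \<inter> enc t) \<union> (\<sigma> ` X \<union> Z')" "(u \<inter> enc t) \<inter> (\<sigma> ` X \<union> Z') = {}" "\<sigma> ` X \<inter> Z' = {}"
      unfolding e using sub \<sigma>X unfolding A_def Y_def Z_def by auto
    moreover have "card (\<sigma> ` X) = card X"
      by (rule card_image, rule inj_on_subset[OF inj]) (use sub in \<open>auto simp: A_def\<close>)
    ultimately have "card (enc t) = (k - r) + (card X + card Z')"
      using cu finX fin by (metis card_Un_disjoint finite_Int finite_UnI finite_imageI)
    then have "card (enc t) = k" using c r by simp
    moreover have "enc t \<subseteq> S"
      unfolding e using sub \<sigma>X PS VD(1)[OF u(1)] unfolding A_def Y_def Z_def by auto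
    moreover have "\<sigma> x \<in> enc t \<longleftrightarrow> x \<notin> enc t" if "x \<in> P" for x
      unfolding encP[OF that] encP[OF \<sigma>(1)[OF that]] \<sigma>(2)[OF that]
      using that tu[OF that] \<sigma>[OF that] sub unfolding A_def by auto
    ultimately show "enc t \<in> T" unfolding T_def V_def using cu by auto
  qed
  also have "\<dots> = (\<Sum>t\<in>I. (- 1) ^ card (fst t)) * f u"
    by (simp add: sum_distrib_right)
  also have "(\<Sum>t\<in>I. (- 1) ^ card (fst t)) = eberlein k (card S - k) r j"
  proof -
    have "I \<subseteq> Pow A \<times> Pow Y \<times> Pow Z" unfolding I_def by auto
    then have "finite I" by (rule finite_subset) (use finAYZ in simp)
    then have "(\<Sum>t\<in>I. (- 1) ^ card (fst t)) = (\<Sum>i\<le>r. \<Sum>t\<in>{t\<in>I. card (fst t) = i}. (- 1) ^ card (fst t) :: real)"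
      by (intro sum.group[symmetric]) (auto simp: I_def)
    also have "\<dots> = (\<Sum>i\<le>r. (- 1) ^ i * real (card {t\<in>I. card (fst t) = i}))"
      by (intro sum.cong refl) (simp add: mult.commute)
    also have "\<dots> = eberlein k (card S - k) r j"
      unfolding eberlein_def
    proof (intro sum.cong refl arg_cong2[where f = "(*)"] arg_cong[where f = real])
      fix i assume "i \<in> {..r}"
      then have "{t\<in>I. card (fst t) = i} = {X. X \<subseteq> A \<and> card X = i} \<times> {Y'. Y' \<subseteq> Y \<and> card Y' = r - i} \<times> {Z'. Z' \<subseteq> Z \<and> card Z' = r - i}"
        unfolding I_def by auto
      then have "card {t\<in>I. card (fst t) = i} = (card A choose i) * ((card Y choose (r - i)) * (card Z choose (r - i)))"
        using finAYZ by (simp add: card_cartesian_product n_subsets)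
      moreover have "card Y = k - j" "card Z = card S - k - j" using cY cZ by auto
      ultimately show "card {t\<in>I. card (fst t) = i} = (j choose i) * ((k - j) choose (r - i)) * ((card S - k - j) choose (r - i))"
        by (simp add: j_def)
    qed
    finally show ?thesis .
  qed
  finally have "(\<Sum>v | v \<in> V \<and> card (u \<inter> v) = k - r. f v) = eberlein k (card S - k) r j * f u" .
  \<comment> \<open>One point of each pair lies in \<open>u\<close>; together with \<open>cY\<close>
    and \<open>cZ\<close> this also bounds the index.\<close>
  moreover have "card P = j + j"
    using card_Int_Diff[OF fin(2), of u] \<open>card (P - u) = j\<close> unfolding j_def A_def by (simp add: Int_commute)
  ultimately show "card P div 2 \<le> min k (card S - k)"
    "(\<Sum>v | v \<in> V \<and> card (u \<inter> v) = k - r. f v) = eberlein k (card S - k) r (card P div 2) * f u"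
    using cY cZ by simp_all
qed

text \<open>The constant function with the empty matching is the instance \<open>j = 0\<close>,
  where the neighbour sum counts neighbours.\<close>

lemma johnson_degree:
  assumes "r \<le> k" "u \<in> V"
  shows "real (card {v. v \<in> V \<and> card (u \<inter> v) = k - r}) = eberlein k (card S - k) r 0"
  using johnson_eigenvalue(2)[of r "{}" id "\<lambda>_. 1" u] assms
  by (simp add: skew_matching_def)

text \<open>An eigenvector for the least eigenvalue \<open>\<mu>\<close> is antisymmetrized inside
  its eigenspace until \<open>johnson_eigenvalue\<close> applies; this exhibits \<open>\<mu>\<close>
  as one of the values bounded below by \<open>- t\<close>.\<close>

lemma johnson_form_bound:
  fixes t :: real
  assumes r: "r \<le> k"
    and t: "\<And>j. j \<le> min k (card S - k) \<Longrightarrow> - t \<le> eberlein k (card S - k) r j"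
  shows "0 \<le> t * (\<Sum>u\<in>V. (g u)\<^sup>2) + (\<Sum>u\<in>V. \<Sum>v | v \<in> V \<and> card (u \<inter> v) = k - r. g u * g v)"
proof (cases "V = {}")
  case False
  define M where "M u v = (if card (u \<inter> v) = k - r then 1 else 0 :: real)" for u v :: "'a set"
  have M: "(\<Sum>v\<in>V. M u v * h v) = (\<Sum>v | v \<in> V \<and> card (u \<inter> v) = k - r. h v)" for u h
  proof -
    have "(\<Sum>v\<in>V. M u v * h v) = (\<Sum>v\<in>V. if card (u \<inter> v) = k - r then h v else 0)"
      by (intro sum.cong) (simp_all add: M_def)
    then show ?thesis by (simp add: sum.inter_filter[OF finite_V])
  qed
  have sym: "M u v = M v u" for u v by (simp add: M_def Int_commute)
  obtain \<mu> f where f: "\<exists>v\<in>V. f v \<noteq> 0" "\<And>u. u \<in> V \<Longrightarrow> (\<Sum>v\<in>V. M u v * f v) = \<mu> * f u"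
    and min: "\<And>g. \<mu> * (\<Sum>u\<in>V. (g u)\<^sup>2) \<le> (\<Sum>u\<in>V. \<Sum>v\<in>V. M u v * g u * g v)"
    using symmetric_min_eigenvector[OF finite_V False, of M, OF sym] by blast
  define W where "W h \<longleftrightarrow> (\<forall>u\<in>V. (\<Sum>v | v \<in> V \<and> card (u \<inter> v) = k - r. h v) = \<mu> * h u)" for h
  have "W f" unfolding W_def using f(2) by (simp add: M)
  moreover have "W (\<lambda>u. h u - h (Transposition.transpose a b ` u))" if h: "W h" and ab: "a \<in> S" "b \<in> S" for h a b
    unfolding W_def
  proof
    fix u assume u: "u \<in> V"
    let ?\<tau> = "(`) (Transposition.transpose a b)"
    \<comment> \<open>A transposition of points preserves intersection sizes, so it maps
      neighbourhoods to neighbourhoods and the eigenspace to itself.\<close>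
    have "(\<Sum>v | v \<in> V \<and> card (u \<inter> v) = k - r. h (?\<tau> v)) = (\<Sum>v | v \<in> V \<and> card (?\<tau> u \<inter> v) = k - r. h v)"
    proof (rule sum.reindex_bij_witness[where i = "?\<tau>" and j = "?\<tau>"])
      have "card (?\<tau> u \<inter> ?\<tau> v) = card (u \<inter> v)" for u v
        by (simp add: image_Int[symmetric] card_image)
      then show "?\<tau> v \<in> {v. v \<in> V \<and> card (?\<tau> u \<inter> v) = k - r}" if "v \<in> {v. v \<in> V \<and> card (u \<inter> v) = k - r}" for v
        using that transpose_image_in_V ab by simp
      show "?\<tau> v \<in> {v. v \<in> V \<and> card (u \<inter> v) = k - r}" if "v \<in> {v. v \<in> V \<and> card (?\<tau> u \<inter> v) = k - r}" for v
        using that transpose_image_in_V ab \<open>\<And>v u. card (?\<tau> u \<inter> ?\<tau> v) = card (u \<inter> v)\<close>[of u "?\<tau> v"] by simp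
    qed simp_all
    also have "\<dots> = \<mu> * h (?\<tau> u)"
      using h transpose_image_in_V[OF u ab] unfolding W_def by blast
    finally show "(\<Sum>v | v \<in> V \<and> card (u \<inter> v) = k - r. h v - h (?\<tau> v)) = \<mu> * (h u - h (?\<tau> u))"
      using h u unfolding W_def by (simp add: sum_subtractf right_diff_distrib)
  qed
  ultimately obtain f' P \<sigma> where f': "W f'" "\<exists>u\<in>V. f' u \<noteq> 0" "skew_matching S V P \<sigma> f'"
    "\<And>c d u. c \<in> S - P \<Longrightarrow> d \<in> S - P \<Longrightarrow> u \<in> V \<Longrightarrow> f' (Transposition.transpose c d ` u) = f' u"
    using maximal_skew_matching[of W f] f(1) by blast
  then obtain u where u: "u \<in> V" "f' u \<noteq> 0" by blast
  then have "\<mu> = eberlein k (card S - k) r (card P div 2)"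
    using johnson_eigenvalue(2)[OF r f'(3) u f'(4)] f'(1) unfolding W_def by simp
  moreover have "card P div 2 \<le> min k (card S - k)"
    using johnson_eigenvalue(1)[OF r f'(3) u f'(4)] .
  ultimately have "- t \<le> \<mu>" using t by simp
  then have "- t * (\<Sum>u\<in>V. (g u)\<^sup>2) \<le> \<mu> * (\<Sum>u\<in>V. (g u)\<^sup>2)"
    by (intro mult_right_mono sum_nonneg) simp_all
  also have "\<dots> \<le> (\<Sum>u\<in>V. \<Sum>v\<in>V. M u v * g u * g v)" by (rule min)
  also have "\<dots> = (\<Sum>u\<in>V. \<Sum>v | v \<in> V \<and> card (u \<inter> v) = k - r. g u * g v)"
    by (rule sum.cong[OF refl]) (simp only: mult.assoc M)
  finally show ?thesis by simp
qed simp

end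

section \<open>Quantum colorings\<close>

lemma finsum_ring_mat:
  fixes f :: "'b \<Rightarrow> 'a :: semiring_1 mat"
  assumes "finite A" "\<And>x. x \<in> A \<Longrightarrow> f x \<in> carrier_mat m m"
  shows "(\<Oplus>\<^bsub>ring_mat TYPE('a) m ()\<^esub>x\<in>A. f x) = mat m m (\<lambda>(i, j). \<Sum>x\<in>A. f x $$ (i, j))"
proof -
  let ?R = "ring_mat TYPE('a) m ()"
  interpret R: semiring ?R by (rule semiring_mat)
  show ?thesis
    using assms
  proof (induction A rule: finite_induct)
    case (insert x A)
    then have "(\<Oplus>\<^bsub>?R\<^esub>y\<in>insert x A. f y) = f x + (\<Oplus>\<^bsub>?R\<^esub>y\<in>A. f y)"
      by (subst R.finsum_insert) (auto simp: ring_mat_simps)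
    also have "(\<Oplus>\<^bsub>?R\<^esub>y\<in>A. f y) = mat m m (\<lambda>(i, j). \<Sum>x\<in>A. f x $$ (i, j))"
      by (rule insert.IH) (use insert.prems in simp)
    finally show ?case
      using insert.prems[of x] insert.hyps by (intro eq_matI) auto
  qed (auto simp: ring_mat_simps intro!: eq_matI)
qed

lemma hermitian_projector_index:
  assumes "hermitian_projector m P" "i < m" "j < m"
  shows "P $$ (j, i) = cnj (P $$ (i, j))"
proof -
  have "P $$ (j, i) = mat_adjoint P $$ (j, i)" using assms(1) by (simp add: hermitian_projector_def)
  also have "\<dots> = cnj (P $$ (i, j))"
  proof -
    have "P \<in> carrier_mat m m" using assms(1) by (simp add: hermitian_projector_def)
    then show ?thesis using assms(2,3) by (simp add: mat_adjoint_def mat_of_rows_def)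
  qed
  finally show ?thesis .
qed

text \<open>The Hilbert-Schmidt inner product is the trace of \<open>P * Q\<close>; this links the
  entrywise quadratic form to the orthogonality relations.\<close>

lemma sum_cnj_mult_hermitian_projectors:
  assumes P: "hermitian_projector m P" and Q: "hermitian_projector m Q"
  shows "(\<Sum>i<m. \<Sum>j<m. cnj (P $$ (i, j)) * Q $$ (i, j)) = (\<Sum>j<m. (P * Q) $$ (j, j))"
proof -
  have dim: "P \<in> carrier_mat m m" "Q \<in> carrier_mat m m"
    using assms by (auto simp: hermitian_projector_def)
  have "(\<Sum>j<m. (P * Q) $$ (j, j)) = (\<Sum>j<m. \<Sum>i<m. P $$ (j, i) * Q $$ (i, j))"
    using dim by (intro sum.cong refl) (auto simp: scalar_prod_def atLeast0LessThan)
  also have "\<dots> = (\<Sum>j<m. \<Sum>i<m. cnj (P $$ (i, j)) * Q $$ (i, j))"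
    by (intro sum.cong refl arg_cong2[where f = "(*)"] hermitian_projector_index[OF P]) simp_all
  finally show ?thesis by (subst sum.swap) simp
qed

text \<open>Apply the form to the real and imaginary parts of the entries of \<open>P v \<alpha> - I / c\<close>. Since
  \<open>P u \<alpha> * P v \<alpha> = 0\<close> along edges, each arc contributes only \<open>- m / c\<close>.\<close>

lemma quantum_coloring_weight_bound:
  fixes G :: "'v pair_pre_digraph" and t :: real
  assumes col: "quantum_coloring G c m P" and m: "0 < m" and c: "0 < c"
    and fin: "finite (pverts G)" and arcs: "parcs G \<subseteq> pverts G \<times> pverts G"
    and form: "\<And>g. 0 \<le> t * (\<Sum>u\<in>pverts G. (g u)\<^sup>2) + (\<Sum>(u, v)\<in>parcs G. g u * g v :: real)"
  shows "t * real (card (pverts G)) + real (card (parcs G)) \<le> real c * t * real (card (pverts G))"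
proof -
  define C where "C = {1..c}"
  define I where "I i j = (if i = j then 1 else 0 :: real)" for i j :: nat
  define X Y where "X \<alpha> i j v = Re (P v \<alpha> $$ (i, j))" and "Y \<alpha> i j v = Im (P v \<alpha> $$ (i, j))" for \<alpha> i j v
  have proj: "hermitian_projector m (P v \<alpha>)" if "v \<in> pverts G" "\<alpha> \<in> C" for v \<alpha>
    using col that unfolding quantum_coloring_def C_def by blast
  have one: "(\<Sum>\<alpha>\<in>C. P v \<alpha> $$ (i, j)) = of_real (I i j)" if "v \<in> pverts G" "i < m" "j < m" for v i j
  proof -
    have "(\<Oplus>\<^bsub>ring_mat TYPE(complex) m ()\<^esub>\<alpha>\<in>C. P v \<alpha>) = 1\<^sub>m m"
      using col that unfolding quantum_coloring_def C_def by blast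
    moreover have "(\<Oplus>\<^bsub>ring_mat TYPE(complex) m ()\<^esub>\<alpha>\<in>C. P v \<alpha>) = mat m m (\<lambda>(i, j). \<Sum>\<alpha>\<in>C. P v \<alpha> $$ (i, j))"
      by (rule finsum_ring_mat) (use proj[OF that(1)] in \<open>auto simp: C_def hermitian_projector_def\<close>)
    ultimately have "mat m m (\<lambda>(i, j). \<Sum>\<alpha>\<in>C. P v \<alpha> $$ (i, j)) $$ (i, j) = 1\<^sub>m m $$ (i, j)"
      by simp
    then show ?thesis using that by (simp add: I_def)
  qed
  \<comment> \<open>Real inner product of the projector families at two vertices. It is
    \<open>m\<close> for \<open>u = v\<close>, because the projectors sum to the identity, and 0
    along arcs.\<close>
  define ip where "ip u v = (\<Sum>\<alpha>\<in>C. \<Sum>i<m. \<Sum>j<m. X \<alpha> i j u * X \<alpha> i j v + Y \<alpha> i j u * Y \<alpha> i j v)" for u v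
  have ip: "ip u v = Re (\<Sum>\<alpha>\<in>C. \<Sum>j<m. (P u \<alpha> * P v \<alpha>) $$ (j, j))" if "u \<in> pverts G" "v \<in> pverts G" for u v
  proof -
    have "ip u v = Re (\<Sum>\<alpha>\<in>C. \<Sum>i<m. \<Sum>j<m. cnj (P u \<alpha> $$ (i, j)) * P v \<alpha> $$ (i, j))"
      unfolding ip_def X_def Y_def by simp
    also have "(\<Sum>\<alpha>\<in>C. \<Sum>i<m. \<Sum>j<m. cnj (P u \<alpha> $$ (i, j)) * P v \<alpha> $$ (i, j))
        = (\<Sum>\<alpha>\<in>C. \<Sum>j<m. (P u \<alpha> * P v \<alpha>) $$ (j, j))"
      by (intro sum.cong refl sum_cnj_mult_hermitian_projectors proj that)
    finally show ?thesis .
  qed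
  have ip_self: "ip v v = real m" if v: "v \<in> pverts G" for v
  proof -
    have "(\<Sum>\<alpha>\<in>C. \<Sum>j<m. (P v \<alpha> * P v \<alpha>) $$ (j, j)) = (\<Sum>\<alpha>\<in>C. \<Sum>j<m. P v \<alpha> $$ (j, j))"
      by (intro sum.cong refl) (use proj[OF v] in \<open>simp add: hermitian_projector_def\<close>)
    also have "\<dots> = (\<Sum>j<m. \<Sum>\<alpha>\<in>C. P v \<alpha> $$ (j, j))" by (rule sum.swap)
    also have "\<dots> = of_nat m" using one[OF v] by (simp add: I_def)
    finally show ?thesis using ip[OF v v] by simp
  qed
  have ip_arc: "ip u v = 0" if uv: "(u, v) \<in> parcs G" for u v
  proof -
    have "P u \<alpha> * P v \<alpha> = 0\<^sub>m m m" if "\<alpha> \<in> C" for \<alpha>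
      using col uv that unfolding quantum_coloring_def C_def by blast
    then show ?thesis using ip[of u v] uv arcs by auto
  qed
  \<comment> \<open>\<open>q\<close> is the inner product of the constant family
    \<open>I / c\<close> with itself and with the family of any vertex, so subtracting that family
    lowers every \<open>ip\<close> by exactly \<open>q\<close>.\<close>
  define q where "q = real m / real c"
  define ip' where "ip' u v = (\<Sum>\<alpha>\<in>C. \<Sum>i<m. \<Sum>j<m. (X \<alpha> i j u - I i j / c) * (X \<alpha> i j v - I i j / c) + Y \<alpha> i j u * Y \<alpha> i j v)" for u v
  have ip': "ip' u v = ip u v - q" if "u \<in> pverts G" "v \<in> pverts G" for u v
  proof -
    have X1: "(\<Sum>\<alpha>\<in>C. \<Sum>i<m. \<Sum>j<m. I i j * X \<alpha> i j w) = real m" if w: "w \<in> pverts G" for w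
    proof -
      have "(\<Sum>\<alpha>\<in>C. \<Sum>i<m. \<Sum>j<m. I i j * X \<alpha> i j w) = (\<Sum>i<m. \<Sum>j<m. \<Sum>\<alpha>\<in>C. I i j * X \<alpha> i j w)"
        by (subst sum.swap, rule sum.cong[OF refl], rule sum.swap)
      also have "\<dots> = (\<Sum>i<m. \<Sum>j<m. I i j * Re (\<Sum>\<alpha>\<in>C. P w \<alpha> $$ (i, j)))"
        by (simp add: X_def sum_distrib_left)
      also have "\<dots> = (\<Sum>i<m. \<Sum>j<m. I i j)"
        using one[OF w] by (intro sum.cong refl) (simp add: I_def)
      also have "\<dots> = real m" by (simp add: I_def)
      finally show ?thesis .
    qed
    have "ip' u v = ip u v - (\<Sum>\<alpha>\<in>C. \<Sum>i<m. \<Sum>j<m. I i j * X \<alpha> i j u) / c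
        - (\<Sum>\<alpha>\<in>C. \<Sum>i<m. \<Sum>j<m. I i j * X \<alpha> i j v) / c
        + (\<Sum>\<alpha>\<in>C. \<Sum>i<m. \<Sum>j<m. I i j * I i j / (real c * real c))"
      unfolding ip'_def ip_def
      by (simp add: algebra_simps sum.distrib sum_subtractf sum_divide_distrib)
    also have "(\<Sum>\<alpha>\<in>C. \<Sum>i<m. \<Sum>j<m. I i j * I i j / (real c * real c)) = q"
    proof -
      have "(\<Sum>i<m. \<Sum>j<m. I i j * I i j / (real c * real c)) = (\<Sum>i<m. 1 / (real c * real c))"
        by (intro sum.cong refl) (simp add: I_def if_distrib[of "\<lambda>x. x * _ / _"] cong: if_cong)
      then show ?thesis using c by (simp add: C_def q_def)
    qed
    finally show ?thesis unfolding X1[OF that(1)] X1[OF that(2)] q_def by simp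
  qed
  have "0 \<le> (\<Sum>\<alpha>\<in>C. \<Sum>i<m. \<Sum>j<m.
      (t * (\<Sum>u\<in>pverts G. (X \<alpha> i j u - I i j / c)\<^sup>2) + (\<Sum>(u, v)\<in>parcs G. (X \<alpha> i j u - I i j / c) * (X \<alpha> i j v - I i j / c)))
    + (t * (\<Sum>u\<in>pverts G. (Y \<alpha> i j u)\<^sup>2) + (\<Sum>(u, v)\<in>parcs G. Y \<alpha> i j u * Y \<alpha> i j v)))"
    by (intro sum_nonneg add_nonneg_nonneg[OF form form])
  also have "\<dots> = (\<Sum>\<alpha>\<in>C. \<Sum>i<m. \<Sum>j<m.
      (\<Sum>u\<in>pverts G. t * ((X \<alpha> i j u - I i j / c) * (X \<alpha> i j u - I i j / c) + Y \<alpha> i j u * Y \<alpha> i j u))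
      + (\<Sum>(u, v)\<in>parcs G. (X \<alpha> i j u - I i j / c) * (X \<alpha> i j v - I i j / c) + Y \<alpha> i j u * Y \<alpha> i j v))"
    by (intro sum.cong refl)
      (simp add: power2_eq_square sum.distrib distrib_left sum_distrib_left case_prod_beta)
  also have "\<dots> = t * (\<Sum>u\<in>pverts G. ip' u u) + (\<Sum>(u, v)\<in>parcs G. ip' u v)"
  proof -
    have swap: "(\<Sum>\<alpha>\<in>C. \<Sum>i<m. \<Sum>j<m. \<Sum>u\<in>D. h \<alpha> i j u) = (\<Sum>u\<in>D. \<Sum>\<alpha>\<in>C. \<Sum>i<m. \<Sum>j<m. h \<alpha> i j u)"
      for D :: "'w set" and h :: "nat \<Rightarrow> nat \<Rightarrow> nat \<Rightarrow> 'w \<Rightarrow> real"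
    proof -
      have "(\<Sum>\<alpha>\<in>C. \<Sum>i<m. \<Sum>j<m. \<Sum>u\<in>D. h \<alpha> i j u) = (\<Sum>\<alpha>\<in>C. \<Sum>i<m. \<Sum>u\<in>D. \<Sum>j<m. h \<alpha> i j u)"
        by (intro sum.cong refl sum.swap)
      also have "\<dots> = (\<Sum>\<alpha>\<in>C. \<Sum>u\<in>D. \<Sum>i<m. \<Sum>j<m. h \<alpha> i j u)"
        by (intro sum.cong refl sum.swap)
      also have "\<dots> = (\<Sum>u\<in>D. \<Sum>\<alpha>\<in>C. \<Sum>i<m. \<Sum>j<m. h \<alpha> i j u)"
        by (rule sum.swap)
      finally show ?thesis .
    qed
    show ?thesis
      unfolding ip'_def case_prod_beta sum.distrib swap
      by (simp add: sum_distrib_left sum.distrib distrib_left)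
  qed
  also have "(\<Sum>u\<in>pverts G. ip' u u) = (\<Sum>u\<in>pverts G. real m - q)"
    by (intro sum.cong refl) (simp add: ip' ip_self)
  also have "(\<Sum>(u, v)\<in>parcs G. ip' u v) = (\<Sum>e\<in>parcs G. - q)"
    using arcs by (intro sum.cong refl) (auto simp: ip' ip_arc)
  finally have "0 \<le> t * (real (card (pverts G)) * (real m - q)) - real (card (parcs G)) * q"
    by simp
  then have "0 \<le> (real c / real m) * (t * (real (card (pverts G)) * (real m - q)) - real (card (parcs G)) * q)"
    by simp
  also have "\<dots> = real c * t * real (card (pverts G)) - t * real (card (pverts G)) - real (card (parcs G))"
    using m c unfolding q_def by (simp add: field_simps)
  finally show ?thesis by simp
qed

section \<open>Rank-one projectors and the colouring with \<open>n\<close> colours\<close>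

definition outer_mat :: "nat \<Rightarrow> (nat \<Rightarrow> complex) \<Rightarrow> complex mat" where
  "outer_mat n w = mat n n (\<lambda>(i, j). w i * cnj (w j) / of_nat n)"

lemma outer_mat_carrier [simp]: "outer_mat n w \<in> carrier_mat n n"
  by (simp add: outer_mat_def)

lemma outer_mat_mult:
  "outer_mat n w * outer_mat n w'
    = mat n n (\<lambda>(i, j). (\<Sum>l<n. cnj (w l) * w' l) * (w i * cnj (w' j)) / (of_nat n * of_nat n))"
proof (rule eq_matI, goal_cases)
  case (1 i j)
  then have "(outer_mat n w * outer_mat n w') $$ (i, j)
      = (\<Sum>l<n. w i * cnj (w l) / of_nat n * (w' l * cnj (w' j) / of_nat n))"
    by (simp add: outer_mat_def scalar_prod_def atLeast0LessThan)
  also have "\<dots> = (\<Sum>l<n. cnj (w l) * w' l) * (w i * cnj (w' j)) / (of_nat n * of_nat n)"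
    unfolding sum_distrib_right sum_divide_distrib by (intro sum.cong refl) simp
  finally show ?case using 1 by simp
qed (simp_all add: outer_mat_def)

lemma outer_mat_mult_orthogonal:
  "(\<Sum>l<n. cnj (w l) * w' l) = 0 \<Longrightarrow> outer_mat n w * outer_mat n w' = 0\<^sub>m n n"
  unfolding outer_mat_mult by (intro eq_matI) auto

text \<open>Unimodular entries give \<open>w\<close> the squared norm \<open>n\<close>, which the
  division in \<open>outer_mat\<close> normalizes.\<close>

lemma hermitian_projector_outer_mat:
  assumes "\<And>l. l < n \<Longrightarrow> cmod (w l) = 1"
  shows "hermitian_projector n (outer_mat n w)"
proof -
  have "cnj (w l) * w l = 1" if "l < n" for l
    using assms[OF that] complex_norm_square[of "w l"] by (simp add: mult.commute)
  then have "(\<Sum>l<n. cnj (w l) * w l) = of_nat n" by simp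
  then have "outer_mat n w * outer_mat n w = outer_mat n w"
    unfolding outer_mat_mult by (auto simp: outer_mat_def intro!: eq_matI)
  moreover have "mat_adjoint (outer_mat n w) = outer_mat n w"
    by (intro eq_matI) (auto simp: mat_adjoint_def mat_of_rows_def outer_mat_def)
  ultimately show ?thesis by (simp add: hermitian_projector_def)
qed

lemma sum_cis_roots_of_unity:
  assumes n: "0 < n" and d: "\<not> int n dvd d"
  shows "(\<Sum>l<n. cis (2 * pi * of_int d * of_nat l / of_nat n)) = 0"
proof -
  define z where "z = cis (2 * pi * of_int d / of_nat n)"
  have "(\<Sum>l<n. cis (2 * pi * of_int d * of_nat l / of_nat n)) = (\<Sum>l<n. z ^ l)"
    unfolding z_def DeMoivre by (intro sum.cong refl) (simp add: mult_ac)
  moreover have "z ^ n = 1"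
  proof -
    have "z ^ n = cis (2 * pi * of_int d)"
      unfolding z_def DeMoivre using n by simp
    then show ?thesis by (simp add: cis_multiple_2pi)
  qed
  moreover have "z \<noteq> 1"
  proof
    assume "z = 1"
    then have "cos (2 * pi * of_int d / of_nat n) = 1"
      unfolding z_def by (simp add: complex_eq_iff)
    then obtain m :: int where "2 * pi * of_int d / of_nat n = of_int m * 2 * pi"
      unfolding cos_one_2pi_int by blast
    then have "real_of_int d = real_of_int (m * int n)" using n by (simp add: field_simps)
    then have "d = m * int n" using of_int_eq_iff by blast
    then show False using d by simp
  qed
  ultimately show ?thesis by (simp add: geometric_sum)
qed

lemma not_dvd_nat_diff:
  assumes "a \<le> m" "b \<le> m" "m < a + n" "m < b + n" "a \<noteq> b"
  shows "\<not> int n dvd int a - int b"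
proof
  assume "int n dvd int a - int b"
  then have "\<bar>int n\<bar> \<le> \<bar>int a - int b\<bar>" using assms(5) by (intro dvd_imp_le_int) simp_all
  then show False using assms by linarith
qed

text \<open>Between equal colours the characters cancel, so orthogonality along arcs is inherited
  from \<open>x\<close>. At a single vertex the factors of \<open>x\<close> cancel by flatness,
  leaving the orthogonality of characters.\<close>

lemma quantum_coloring_flat_representation:
  fixes x :: "'v \<Rightarrow> nat \<Rightarrow> complex"
  assumes n: "0 < n" and flat: "\<And>v l. cmod (x v l) = 1"
    and orth: "\<And>u v. (u, v) \<in> parcs G \<Longrightarrow> (\<Sum>l<n. cnj (x u l) * x v l) = 0"
  defines "w \<equiv> \<lambda>v \<alpha> l. x v l * cis (2 * pi * of_nat \<alpha> * of_nat l / of_nat n)"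
  shows "quantum_coloring G n n (\<lambda>v \<alpha>. outer_mat n (w v \<alpha>))"
proof -
  have w_cnj: "cnj (w u \<alpha> i) * w v \<beta> j = cnj (x u i) * x v j *
      cis (2 * pi * (of_nat \<beta> * of_nat j - of_nat \<alpha> * of_nat i) / of_nat n)" for u v \<alpha> \<beta> i j
    unfolding w_def by (simp add: cis_cnj cis_mult algebra_simps diff_divide_distrib)
  have cc: "cnj (x v l) * x v l = 1" for v l
    using flat[of v l] complex_norm_square[of "x v l"] by (simp add: mult.commute)
  show ?thesis
    unfolding quantum_coloring_def
  proof (intro conjI ballI impI)
    fix v \<alpha> show "hermitian_projector n (outer_mat n (w v \<alpha>))"
      by (rule hermitian_projector_outer_mat) (simp add: w_def norm_mult flat)
  next
    fix v \<alpha> \<beta> assume \<alpha>: "\<alpha> \<in> {1..n}" "\<beta> \<in> {1..n}" "\<alpha> \<noteq> \<beta>"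
    have "(\<Sum>l<n. cnj (w v \<alpha> l) * w v \<beta> l)
        = (\<Sum>l<n. cis (2 * pi * of_int (int \<beta> - int \<alpha>) * of_nat l / of_nat n))"
      unfolding w_cnj cc by (intro sum.cong refl) (simp add: algebra_simps)
    also have "\<dots> = 0"
      using \<alpha> n by (intro sum_cis_roots_of_unity not_dvd_nat_diff[where m = n]) auto
    finally show "outer_mat n (w v \<alpha>) * outer_mat n (w v \<beta>) = 0\<^sub>m n n"
      by (rule outer_mat_mult_orthogonal)
  next
    fix v
    have sum: "(\<Sum>\<alpha>\<in>{1..n}. w v \<alpha> i * cnj (w v \<alpha> j) / of_nat n) = (if i = j then 1 else 0)"
      if "i < n" "j < n" for i j
    proof -
      define d where "d = int i - int j"
      have "(\<Sum>\<alpha>\<in>{1..n}. w v \<alpha> i * cnj (w v \<alpha> j) / of_nat n)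
          = (\<Sum>\<alpha>\<in>{1..n}. x v i * cnj (x v j) / of_nat n * cis (2 * pi * of_int d * of_nat \<alpha> / of_nat n))"
        using w_cnj[of v _ j v _ i] by (intro sum.cong refl) (simp add: d_def algebra_simps)
      also have "\<dots> = x v i * cnj (x v j) / of_nat n * (\<Sum>\<alpha>\<in>{1..n}. cis (2 * pi * of_int d * of_nat \<alpha> / of_nat n))"
        by (simp add: sum_distrib_left)
      \<comment> \<open>Colours start at 1, which contributes a constant factor; it is 1 for
        \<open>i = j\<close> and harmless otherwise, since the sum vanishes.\<close>
      also have "(\<Sum>\<alpha>\<in>{1..n}. cis (2 * pi * of_int d * of_nat \<alpha> / of_nat n))
          = (\<Sum>l<n. cis (2 * pi * of_int d / of_nat n) * cis (2 * pi * of_int d * of_nat l / of_nat n))"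
        by (simp add: sum.atLeast1_atMost_eq cis_mult add_divide_distrib[symmetric] algebra_simps)
      also have "\<dots> = (if i = j then of_nat n else 0)"
      proof (cases "i = j")
        case False
        then have "\<not> int n dvd d"
          unfolding d_def using that by (intro not_dvd_nat_diff[where m = "n - 1"]) auto
        with False n show ?thesis
          by (simp add: sum_distrib_left[symmetric] sum_cis_roots_of_unity)
      qed (simp add: d_def)
      finally show ?thesis using n cc[of v i] by (auto simp: mult.commute)
    qed
    have "(\<Oplus>\<^bsub>ring_mat TYPE(complex) n ()\<^esub>\<alpha>\<in>{1..n}. outer_mat n (w v \<alpha>))
        = mat n n (\<lambda>(i, j). \<Sum>\<alpha>\<in>{1..n}. outer_mat n (w v \<alpha>) $$ (i, j))"
      by (rule finsum_ring_mat) auto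
    also have "\<dots> = 1\<^sub>m n"
      by (intro eq_matI) (auto simp: outer_mat_def sum simp del: One_nat_def)
    finally show "(\<Oplus>\<^bsub>ring_mat TYPE(complex) n ()\<^esub>\<alpha>\<in>{1..n}. outer_mat n (w v \<alpha>)) = 1\<^sub>m n" .
  next
    fix e assume e: "e \<in> parcs G"
    obtain u v where uv: "e = (u, v)" by (cases e)
    have "outer_mat n (w u \<alpha>) * outer_mat n (w v \<alpha>) = 0\<^sub>m n n" for \<alpha>
      by (rule outer_mat_mult_orthogonal) (use orth e uv in \<open>simp add: w_cnj\<close>)
    then show "case e of (u, v) \<Rightarrow> \<forall>\<alpha>\<in>{1..n}. outer_mat n (w u \<alpha>) * outer_mat n (w v \<alpha>) = 0\<^sub>m n n"
      by (simp add: uv)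
  qed
qed

lemma quantum_colorable_johnson:
  assumes n: "0 < n" and r: "1 \<le> r" "r \<le> k" "n \<le> 4 * r"
  shows "quantum_colorable (generalized_johnson_graph n k (k - r)) n"
proof -
  \<comment> \<open>\<open>n \<le> 4 * r\<close> is exactly what keeps the argument of
    \<open>arccos\<close> at least -1.\<close>
  define \<theta> where "\<theta> = arccos (1 - real n / (2 * real r))"
  have cos: "cos \<theta> = 1 - real n / (2 * real r)"
    unfolding \<theta>_def using r by (intro cos_arccos) (simp_all add: field_simps)
  \<comment> \<open>Matrix indices start at 0 and points at 1, hence \<open>Suc l\<close>.\<close>
  define x where "x A l = (if Suc l \<in> A then cis \<theta> else 1)" for A :: "nat set" and l :: nat
  have "(\<Sum>l<n. cnj (x A l) * x B l) = 0"
    if "(A, B) \<in> parcs (generalized_johnson_graph n k (k - r))" for A B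
  proof -
    have AB: "A \<subseteq> {1..n}" "card A = k" "B \<subseteq> {1..n}" "card B = k" "card (A \<inter> B) = k - r"
      using that by (auto simp: parcs_generalized_johnson_graph)
    have fin: "finite A" "finite B" using AB finite_subset by auto
    have count: "card ({..<n} \<inter> {l. Suc l \<in> D}) = card D" if "D \<subseteq> {1..n}" for D
    proof (rule bij_betw_same_card[of Suc])
      show "bij_betw Suc ({..<n} \<inter> {l. Suc l \<in> D}) D"
        using that by (intro bij_betw_byWitness[where f' = "\<lambda>l. l - 1"]) (auto simp: subset_iff)
    qed
    have diff: "card (A - B) = r" "card (B - A) = r"
      using card_Int_Diff[OF fin(1), of B] card_Int_Diff[OF fin(2), of A] AB r
      by (simp_all add: Int_commute)
    \<comment> \<open>Positions in both or neither set contribute 1; the \<open>r\<close> positions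
      of each difference contribute \<open>cis \<theta>\<close> or its conjugate.\<close>
    have "(\<Sum>l<n. cnj (x A l) * x B l)
        = (\<Sum>l<n. 1 + (if Suc l \<in> A - B then cnj (cis \<theta>) - 1 else 0) + (if Suc l \<in> B - A then cis \<theta> - 1 else 0))"
      by (intro sum.cong refl) (auto simp: x_def cis_cnj cis_mult)
    also have "\<dots> = of_nat n + of_nat (card (A - B)) * (cnj (cis \<theta>) - 1) + of_nat (card (B - A)) * (cis \<theta> - 1)"
      using count[of "A - B"] count[of "B - A"] AB
      by (simp add: sum.distrib sum.If_cases subset_iff Int_def)
    also have "\<dots> = of_real (real n + real r * (2 * cos \<theta> - 2))"
      unfolding diff by (simp add: complex_eq_iff algebra_simps)
    also have "real n + real r * (2 * cos \<theta> - 2) = 0"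
      unfolding cos using r by (simp add: field_simps)
    finally show ?thesis by simp
  qed
  then have "quantum_coloring (generalized_johnson_graph n k (k - r)) n n
      (\<lambda>v \<alpha>. outer_mat n (\<lambda>l. x v l * cis (2 * pi * of_nat \<alpha> * of_nat l / of_nat n)))"
    by (intro quantum_coloring_flat_representation n) (simp_all add: x_def)
  then show ?thesis
    unfolding quantum_colorable_def using n by blast
qed

section \<open>The lower bound for the generalized Johnson graphs\<close>

lemma quantum_colorable_johnson_lower_bound:
  assumes r: "0 < r" "r \<le> k" "r \<le> n - k" and n: "n \<le> 4 * r"
    and eq: "r * (n - 1) = k * (n - k)"
    and c: "0 < c" and col: "quantum_colorable (generalized_johnson_graph n k (k - r)) c"
  shows "n \<le> c"
proof -
  define G where "G = generalized_johnson_graph n k (k - r)"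
  interpret slice "{1..n}" k by unfold_locales simp
  have kn: "k + (n - k) = n" and n2: "2 \<le> n" using r by simp_all
  \<comment> \<open>\<open>d\<close> is the degree, and this \<open>t\<close> makes the Hoffman
    bound \<open>1 + d / t\<close> equal to \<open>n\<close>.\<close>
  define d t where "d = eberlein k (n - k) r 0" and "t = d / (real n - 1)"
  have d: "0 < d" unfolding d_def eberlein_0 using r by simp
  have n1: "0 < real n - 1" using n2 by simp
  have verts: "pverts G = V"
    unfolding G_def V_def by (rule pverts_generalized_johnson_graph)
  \<comment> \<open>A vertex meets itself in \<open>k\<close> points, which differs from
    \<open>k - r\<close> as \<open>0 < r \<le> k\<close>.\<close>
  have arcs: "parcs G = Sigma V (\<lambda>u. {v. v \<in> V \<and> card (u \<inter> v) = k - r})"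
    unfolding G_def V_def parcs_generalized_johnson_graph using r by auto
  have form: "0 \<le> t * (\<Sum>u\<in>pverts G. (g u)\<^sup>2) + (\<Sum>(u, v)\<in>parcs G. g u * g v)" for g
  proof -
    have "- t \<le> eberlein k (card {1..n} - k) r j" if "j \<le> min k (card {1..n} - k)" for j
    proof (cases "j = 0")
      case True
      then show ?thesis using d n1 by (simp add: t_def d_def order_trans[of _ 0])
    next
      case False
      then have "\<bar>eberlein k (n - k) r j\<bar> * (real n - 1) \<le> d"
        using eberlein_bound[of r k "n - k" j] that r n eq unfolding kn d_def by simp
      then have "\<bar>eberlein k (n - k) r j\<bar> \<le> t"
        using n1 by (simp add: t_def pos_le_divide_eq)
      then show ?thesis by simp
    qed
    then have "0 \<le> t * (\<Sum>u\<in>V. (g u)\<^sup>2) + (\<Sum>u\<in>V. \<Sum>v | v \<in> V \<and> card (u \<inter> v) = k - r. g u * g v)"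
      by (intro johnson_form_bound r(2))
    then show ?thesis
      unfolding verts arcs using finite_V by (simp add: sum.Sigma)
  qed
  have "real (card (parcs G)) = (\<Sum>u\<in>V. real (card {v. v \<in> V \<and> card (u \<inter> v) = k - r}))"
    unfolding arcs using finite_V by simp
  also have "\<dots> = real (card V) * d"
    using johnson_degree[OF r(2)] by (simp add: d_def)
  finally have card_arcs: "real (card (parcs G)) = real (card V) * d" .
  obtain m P where "0 < m" "quantum_coloring G c m P"
    using col unfolding quantum_colorable_def G_def by blast
  then have "t * real (card V) + real (card V) * d \<le> real c * t * real (card V)"
    using quantum_coloring_weight_bound[of G c m P t] c form finite_V card_arcs
    unfolding verts by (auto simp: arcs)
  then have "real (card V) * (t + d) \<le> real (card V) * (real c * t)"
    by (simp add: algebra_simps)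
  moreover have "card V > 0"
    unfolding V_def using n_subsets[of "{1..n}" k] r by simp
  ultimately have "t + d \<le> real c * t" by simp
  then have "(t + d) * (real n - 1) \<le> real c * t * (real n - 1)"
    using n1 by (intro mult_right_mono) simp_all
  moreover have t_n: "t * (real n - 1) = d" using n1 by (simp add: t_def)
  have "(t + d) * (real n - 1) = d * real n"
    unfolding distrib_right t_n by (simp add: right_diff_distrib)
  moreover have "real c * t * (real n - 1) = d * real c"
    unfolding mult.assoc t_n by (rule mult.commute)
  ultimately have "d * real n \<le> d * real c" by simp
  then show ?thesis using d by simp
qed

theorem theorem1:
  fixes n k r :: nat
  assumes "0 < n" and "0 < k" and "1 \<le> r" and "r \<le> min k (n - k)"
    and "r * (n - 1) = k * (n - k)"
    and "real r \<ge> real n / 4"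
  shows "quantum_chromatic_number (generalized_johnson_graph n k (k - r)) = n"
  unfolding quantum_chromatic_number_def
proof (rule Least_equality)
  have n: "n \<le> 4 * r" using assms(6) by linarith
  then show "0 < n \<and> quantum_colorable (generalized_johnson_graph n k (k - r)) n"
    using assms by (intro conjI quantum_colorable_johnson) simp_all
  show "n \<le> c" if "0 < c \<and> quantum_colorable (generalized_johnson_graph n k (k - r)) c" for c
    using that assms n by (intro quantum_colorable_johnson_lower_bound[of r k n c]) simp_all
qed

end
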